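(* Let $\mu_n$ be the Ising measure on $\Xi_n=\{-1,+1\}^{V_n}$ with surface potential $a(n)$ and pair potential $b(n)$. Assume that for all $n$, $a(n)<0$, and that there exists $b_0>0$ such that $|b(n)|<b_0$ for all $n$. Let $L$ be a basic local sentence, let $k(L)$ be its index, and let $\mu_n(L)=\mu_n(\{\eta\in\Xi_n:\eta\models L\})$. (a) If $L$ is satisfiable and $k(L)>0$, then its threshold function for $e^{a(n)}$ is $n^{-\frac{d}{2k(L)}}$; that is, $\mu_n(L)$ tends to $0$ if $e^{a(n)}n^{\frac{d}{2k(L)}}$ tends to $0$, and $\mu_n(L)$ tends to $1$ if $e^{a(n)}n^{\frac{d}{2k(L)}}$ tends to $+\infty$, as $n\to\infty$. (b) If $k(L)=0$, then $\mu_n(L)$ tends to $1$ as $n\to\infty$.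
   Context: Lattice torus. Fix a dimension $d$, $p$ with $1\le p\le\infty$, and a parameter $\rho$. For each $n$, $V_n=\{0,\ldots,n-1\}^d$, with all operations on vertices taken componentwise modulo $n$ (periodic boundary conditions). $G_n=(V_n,E_n)$ is the undirected graph in which the neighbors of $x$ are the $y\ne x$ in $V_n$ with $\|y-x\|_p\le\rho$, where the subtraction is taken componentwise modulo $n$ and $\|\cdot\|_p$ is the $L_p$ norm on $\mathbb{R}^d$. $dist$ is the graph distance in $G_n$ and $B(x,r)=\{y\in V_n: dist(x,y)\le r\}$. It is always assumed that $n>2\rho r$ when balls of radius $r$ are considered; then these balls are translates of each other, $B(x+y,r)=y+B(x,r)$, and balls of radius $r$ for different such $n$ are isomorphic. Ising measure. $a(n)$ and $b(n)$ are reals depending on $n$, and for $\eta\in\Xi_n=\{-1,+1\}^{V_n}$, $$\mu_n(\eta)=\frac1Z\exp\Big(a(n)\sum_{x\in V_n}\eta(x)+b(n)\sum_{\{x,y\}\in E_n}\eta(x)\eta(y)\Big),$$ where $Z$ (depending on $n$) is the constant making $\mu_n$ a probability measure on $\Xi_n$. Logic. The vocabulary consists of one unary predicate $C$ and some binary predicates, applied to the domain $V_n$. In all structures considered, the list of facts relative to the binary predicates is fixed, so that the associated graph, which joins those pairs $\{x,y\}$ such that $Rxy$ or $Ryx$ holds for some binary predicate $R$, is the lattice torus $G_n$. Structures thus differ only by their unary facts, and a structure is identified with the configuration $\eta\in\Xi_n$ such that $\eta(x)=+1$ if $Cx$ holds and $\eta(x)=-1$ if $\neg Cx$ holds. First-order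 formulas are obtained from atoms ($Cx$, $Rxy$, etc.) by negation, conjunction and quantification over variables in the domain; a sentence is a formula all of whose variables are quantified. $\eta\models A$ means that the structure identified with $\eta$ satisfies $A$. Basic local sentence. A sentence of the form $$\exists x_1\ldots\exists x_m\ \Big(\bigwedge_{1\le i<j\le m}dist(x_i,x_j)>2r\Big)\wedge\Big(\bigwedge_{1\le i\le m}\psi_i(x_i)\Big),$$ where $m,r$ are fixed nonnegative integers and each $\psi_i(x)$ is a first-order formula for which only the variable $x$ is free (not bound by a quantifier), and the other variables all belong to the ball $B(x,r)$. Complete description. A complete description $D(x)$ of the ball $B(x,r)$ asserts or negates all statements concerning the vertices of that ball; it describes exactly one local configuration on $B(x,r)$, which is the translate to $B(x,r)$ of a local configuration on $B(0,r)$. Index. If $L$ is not satisfiable, $k(L)=+\infty$. If $L$ is satisfiable, for each $i=1,\ldots,m$ consider the finite set $\{D_{i,1},\ldots,D_{i,d_i}\}$ of those complete descriptions on the ball $B(x_i,r)$ which imply $\psi_i(x_i)$, so that $\psi_i(x_i)$ is equivalent to $\bigvee_{1\le j\le d_i}D_{i,j}(x_i)$. Each $D_{i,j}(x_i)$ corresponds to a configuration on $B(x_i,r)$; let $k_{i,j}$ be its number of $+1$'s. The index of $L$ is $$k(L)=\max_{1\le i\le m}\ \min_{1\le j\le d_i}k_{i,j}.$$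
   Formalization: The binary facts are assumed translation invariant and independent of n for n > 2ρ (otherwise the index is ill-defined), and satisfiability and complete descriptions refer to n > 2ρ(r+1), since balls of radius r need not be isomorphic for all n > 2ρr. *)

theory Defs
  imports "HOL-Analysis.Analysis" "HOL-Library.Extended_Nat"
begin

section \<open>The lattice torus\<close>

definition torus_vertices :: "nat \<Rightarrow> (int ^ 'd) set" where
  "torus_vertices n = {x. \<forall>i. 0 \<le> x $ i \<and> x $ i < int n}"

definition torus_mod :: "nat \<Rightarrow> int ^ 'd \<Rightarrow> int ^ 'd" where
  "torus_mod n x = (\<chi> i. x $ i mod int n)"

text \<open>Absolute value of the representative of \<open>k\<close> modulo \<open>n\<close> that is nearest to 0. Differences of
  vertices are measured this way; the representative in \<open>{0..<n}\<close> would not give a symmetric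
  adjacency.\<close>

definition circ_abs :: "nat \<Rightarrow> int \<Rightarrow> int" where
  "circ_abs n k = min (k mod int n) ((- k) mod int n)"

definition lp_norm :: "ereal \<Rightarrow> real ^ 'd \<Rightarrow> real" where
  "lp_norm p v =
     (if p = \<infinity> then infnorm v
      else (\<Sum>i\<in>UNIV. \<bar>v $ i\<bar> powr real_of_ereal p) powr (1 / real_of_ereal p))"

definition torus_adj :: "ereal \<Rightarrow> real \<Rightarrow> nat \<Rightarrow> int ^ 'd \<Rightarrow> int ^ 'd \<Rightarrow> bool" where
  "torus_adj p \<rho> n x y \<longleftrightarrow>
     x \<in> torus_vertices n \<and> y \<in> torus_vertices n \<and> x \<noteq> y \<and>
     lp_norm p (\<chi> i. real_of_int (circ_abs n (y $ i - x $ i))) \<le> \<rho>"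

definition torus_edges :: "ereal \<Rightarrow> real \<Rightarrow> nat \<Rightarrow> (int ^ 'd) set set" where
  "torus_edges p \<rho> n = {{x, y} |x y. torus_adj p \<rho> n x y}"

text \<open>The value is \<open>\<infinity>\<close> if there is no path, which happens for \<open>\<rho> < 1\<close>.\<close>

definition graph_dist :: "('v \<Rightarrow> 'v \<Rightarrow> bool) \<Rightarrow> 'v \<Rightarrow> 'v \<Rightarrow> enat" where
  "graph_dist E x y = (INF k\<in>{k. (E ^^ k) x y}. enat k)"

definition torus_ball :: "ereal \<Rightarrow> real \<Rightarrow> nat \<Rightarrow> int ^ 'd \<Rightarrow> nat \<Rightarrow> (int ^ 'd) set" where
  "torus_ball p \<rho> n x r = {y \<in> torus_vertices n. graph_dist (torus_adj p \<rho> n) x y \<le> enat r}"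

text \<open>The ball of radius \<open>r\<close> around 0 of the infinite lattice \<open>\<int>\<^sup>d\<close>. It serves as the common model of
  the balls of radius \<open>r\<close> of all sufficiently large tori.\<close>

definition lattice_adj :: "ereal \<Rightarrow> real \<Rightarrow> int ^ 'd \<Rightarrow> int ^ 'd \<Rightarrow> bool" where
  "lattice_adj p \<rho> x y \<longleftrightarrow> x \<noteq> y \<and> lp_norm p (\<chi> i. real_of_int (y $ i - x $ i)) \<le> \<rho>"

definition lattice_ball :: "ereal \<Rightarrow> real \<Rightarrow> nat \<Rightarrow> (int ^ 'd) set" where
  "lattice_ball p \<rho> r = {z. graph_dist (lattice_adj p \<rho>) 0 z \<le> enat r}"

text \<open>The bound \<open>n > 2 * \<rho> * r\<close> makes the projection of the lattice ball to the torus ball injective,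
  but the ball may still wrap around: for \<open>d = r = 1\<close>, \<open>\<rho> = 1\<close>, \<open>n = 3\<close> it is a triangle, and a path
  of length 2 for all larger \<open>n\<close>. The same bound for radius \<open>r + 1\<close> excludes this, and the balls
  of radius \<open>r\<close>, with the relations on them, are then isomorphic for all such \<open>n\<close>.\<close>

definition admissible :: "real \<Rightarrow> nat \<Rightarrow> nat \<Rightarrow> bool" where
  "admissible \<rho> r n \<longleftrightarrow> 2 * \<rho> * (real r + 1) < real n"


section \<open>The Ising measure\<close>

definition configs :: "nat \<Rightarrow> (int ^ 'd \<Rightarrow> real) set" where
  "configs n = torus_vertices n \<rightarrow>\<^sub>E {-1, 1}"

definition ising_weight ::
  "ereal \<Rightarrow> real \<Rightarrow> nat \<Rightarrow> real \<Rightarrow> real \<Rightarrow> (int ^ 'd \<Rightarrow> real) \<Rightarrow> real" where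
  "ising_weight p \<rho> n \<alpha> \<beta> \<eta> =
     exp (\<alpha> * (\<Sum>x\<in>torus_vertices n. \<eta> x) + \<beta> * (\<Sum>e\<in>torus_edges p \<rho> n. \<Prod>x\<in>e. \<eta> x))"

definition ising_measure ::
  "ereal \<Rightarrow> real \<Rightarrow> nat \<Rightarrow> real \<Rightarrow> real \<Rightarrow> (int ^ 'd \<Rightarrow> real) measure" where
  "ising_measure p \<rho> n \<alpha> \<beta> =
     (let Z = (\<Sum>\<xi>\<in>(configs n :: (int ^ 'd \<Rightarrow> real) set). ising_weight p \<rho> n \<alpha> \<beta> \<xi>)
      in point_measure (configs n) (\<lambda>\<eta>. ennreal (ising_weight p \<rho> n \<alpha> \<beta> \<eta> / Z)))"


section \<open>First-order formulas\<close>

text \<open>\<open>'r\<close> is the type of names of the binary predicates; variables are natural numbers.\<close>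

datatype 'r fm =
    Eq nat nat
  | Color nat
  | Rel 'r nat nat
  | Neg "'r fm"
  | Conj "'r fm" "'r fm"
  | Exi nat "'r fm"
  | Uni nat "'r fm"

fun free_vars :: "'r fm \<Rightarrow> nat set" where
  "free_vars (Eq u v) = {u, v}"
| "free_vars (Color u) = {u}"
| "free_vars (Rel R u v) = {u, v}"
| "free_vars (Neg A) = free_vars A"
| "free_vars (Conj A B) = free_vars A \<union> free_vars B"
| "free_vars (Exi u A) = free_vars A - {u}"
| "free_vars (Uni u A) = free_vars A - {u}"

fun sat ::
  "'v set \<Rightarrow> ('r \<Rightarrow> 'v \<Rightarrow> 'v \<Rightarrow> bool) \<Rightarrow> ('v \<Rightarrow> bool) \<Rightarrow> (nat \<Rightarrow> 'v) \<Rightarrow> 'r fm \<Rightarrow> bool" where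
  "sat D I C \<sigma> (Eq u v) \<longleftrightarrow> \<sigma> u = \<sigma> v"
| "sat D I C \<sigma> (Color u) \<longleftrightarrow> C (\<sigma> u)"
| "sat D I C \<sigma> (Rel R u v) \<longleftrightarrow> I R (\<sigma> u) (\<sigma> v)"
| "sat D I C \<sigma> (Neg A) \<longleftrightarrow> \<not> sat D I C \<sigma> A"
| "sat D I C \<sigma> (Conj A B) \<longleftrightarrow> sat D I C \<sigma> A \<and> sat D I C \<sigma> B"
| "sat D I C \<sigma> (Exi u A) \<longleftrightarrow> (\<exists>v\<in>D. sat D I C (\<sigma>(u := v)) A)"
| "sat D I C \<sigma> (Uni u A) \<longleftrightarrow> (\<forall>v\<in>D. sat D I C (\<sigma>(u := v)) A)"

text \<open>\<open>I n R\<close> interprets the binary predicate \<open>R\<close> on the torus of size \<open>n\<close>. The first condition says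
  that the associated graph is the lattice torus. The other two say that the facts about binary
  predicates are invariant under translations and do not depend on \<open>n\<close>, for all \<open>n\<close> large
  enough for radius 1; without them balls would not be isomorphic as structures.\<close>

definition torus_interpretation ::
  "ereal \<Rightarrow> real \<Rightarrow> (nat \<Rightarrow> 'r \<Rightarrow> int ^ 'd \<Rightarrow> int ^ 'd \<Rightarrow> bool) \<Rightarrow> bool" where
  "torus_interpretation p \<rho> I \<longleftrightarrow>
     (\<forall>n. \<forall>x\<in>torus_vertices n. \<forall>y\<in>torus_vertices n. x \<noteq> y \<longrightarrow>
        ((\<exists>R. I n R x y \<or> I n R y x) \<longleftrightarrow> torus_adj p \<rho> n x y)) \<and>
     (\<forall>n R. \<forall>x\<in>torus_vertices n. \<forall>y\<in>torus_vertices n. \<forall>z\<in>torus_vertices n.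
        I n R (torus_mod n (x + z)) (torus_mod n (y + z)) \<longleftrightarrow> I n R x y) \<and>
     (\<forall>n n' R z. 2 * \<rho> < real n \<longrightarrow> 2 * \<rho> < real n' \<longrightarrow>
        (\<forall>i. 2 * \<bar>z $ i\<bar> < int n \<and> 2 * \<bar>z $ i\<bar> < int n') \<longrightarrow>
        (I n R 0 (torus_mod n z) \<longleftrightarrow> I n' R 0 (torus_mod n' z)))"


section \<open>Basic local sentences and their index\<close>

text \<open>A basic local sentence is given by \<open>r\<close> and the list of the formulas \<open>\<psi>\<^sub>1, \<dots>, \<psi>\<^sub>m\<close>, in each of
  which the free variable \<open>x\<close> is variable 0. Indices start at 0.\<close>

record 'r local_sentence =
  radius :: nat
  parts :: "'r fm list"

definition basic_local :: "'r local_sentence \<Rightarrow> bool" where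
  "basic_local L \<longleftrightarrow> (\<forall>\<psi>\<in>set (parts L). free_vars \<psi> \<subseteq> {0})"

text \<open>Quantifiers of \<open>\<psi>\<close> range over the ball of radius \<open>r\<close> around \<open>x\<close>.\<close>

definition sat_local ::
  "ereal \<Rightarrow> real \<Rightarrow> (nat \<Rightarrow> 'r \<Rightarrow> int ^ 'd \<Rightarrow> int ^ 'd \<Rightarrow> bool) \<Rightarrow> nat \<Rightarrow> (int ^ 'd \<Rightarrow> real) \<Rightarrow>
   nat \<Rightarrow> 'r fm \<Rightarrow> int ^ 'd \<Rightarrow> bool" where
  "sat_local p \<rho> I n \<eta> r \<psi> x \<longleftrightarrow>
     sat (torus_ball p \<rho> n x r) (I n) (\<lambda>v. \<eta> v = 1) (\<lambda>_. x) \<psi>"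

definition models ::
  "ereal \<Rightarrow> real \<Rightarrow> (nat \<Rightarrow> 'r \<Rightarrow> int ^ 'd \<Rightarrow> int ^ 'd \<Rightarrow> bool) \<Rightarrow> nat \<Rightarrow> (int ^ 'd \<Rightarrow> real) \<Rightarrow>
   'r local_sentence \<Rightarrow> bool" where
  "models p \<rho> I n \<eta> L \<longleftrightarrow>
     (\<exists>x :: nat \<Rightarrow> int ^ 'd.
        (\<forall>i<length (parts L). x i \<in> torus_vertices n) \<and>
        (\<forall>j<length (parts L). \<forall>i<j.
           graph_dist (torus_adj p \<rho> n) (x i) (x j) > enat (2 * radius L)) \<and>
        (\<forall>i<length (parts L). sat_local p \<rho> I n \<eta> (radius L) (parts L ! i) (x i)))"

definition satisfiable ::
  "ereal \<Rightarrow> real \<Rightarrow> (nat \<Rightarrow> 'r \<Rightarrow> int ^ 'd \<Rightarrow> int ^ 'd \<Rightarrow> bool) \<Rightarrow> 'r local_sentence \<Rightarrow> bool" where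
  "satisfiable p \<rho> I L \<longleftrightarrow>
     (\<exists>n. admissible \<rho> (radius L) n \<and> (\<exists>\<eta>\<in>configs n. models p \<rho> I n \<eta> L))"

text \<open>A complete description of balls of radius \<open>r\<close> is identified with the local configuration \<open>\<zeta>\<close> on
  the ball around 0 which it describes; \<open>describes p \<rho> n r \<zeta> x \<eta>\<close> says that it holds at \<open>x\<close> in \<open>\<eta>\<close>.\<close>

definition local_configs :: "ereal \<Rightarrow> real \<Rightarrow> nat \<Rightarrow> (int ^ 'd \<Rightarrow> real) set" where
  "local_configs p \<rho> r = lattice_ball p \<rho> r \<rightarrow>\<^sub>E {-1, 1}"

definition describes ::
  "ereal \<Rightarrow> real \<Rightarrow> nat \<Rightarrow> nat \<Rightarrow> (int ^ 'd \<Rightarrow> real) \<Rightarrow> int ^ 'd \<Rightarrow> (int ^ 'd \<Rightarrow> real) \<Rightarrow> bool" where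
  "describes p \<rho> n r \<zeta> x \<eta> \<longleftrightarrow> (\<forall>z\<in>lattice_ball p \<rho> r. \<eta> (torus_mod n (x + z)) = \<zeta> z)"

definition descriptions_implying ::
  "ereal \<Rightarrow> real \<Rightarrow> (nat \<Rightarrow> 'r \<Rightarrow> int ^ 'd \<Rightarrow> int ^ 'd \<Rightarrow> bool) \<Rightarrow> nat \<Rightarrow> 'r fm \<Rightarrow>
   (int ^ 'd \<Rightarrow> real) set" where
  "descriptions_implying p \<rho> I r \<psi> =
     {\<zeta> \<in> local_configs p \<rho> r.
        \<forall>n. admissible \<rho> r n \<longrightarrow>
          (\<forall>x\<in>torus_vertices n. \<forall>\<eta>\<in>configs n.
             describes p \<rho> n r \<zeta> x \<eta> \<longrightarrow> sat_local p \<rho> I n \<eta> r \<psi> x)}"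

definition num_plus :: "ereal \<Rightarrow> real \<Rightarrow> nat \<Rightarrow> (int ^ 'd \<Rightarrow> real) \<Rightarrow> nat" where
  "num_plus p \<rho> r \<zeta> = card {z \<in> lattice_ball p \<rho> r. \<zeta> z = 1}"

text \<open>For \<open>m = 0\<close> the supremum in \<open>enat\<close> is 0.\<close>

definition index_of ::
  "ereal \<Rightarrow> real \<Rightarrow> (nat \<Rightarrow> 'r \<Rightarrow> int ^ 'd \<Rightarrow> int ^ 'd \<Rightarrow> bool) \<Rightarrow> 'r local_sentence \<Rightarrow> enat" where
  "index_of p \<rho> I L =
     (if satisfiable p \<rho> I L then
        (SUP i\<in>{..<length (parts L)}.
           INF \<zeta>\<in>descriptions_implying p \<rho> I (radius L) (parts L ! i).
             enat (num_plus p \<rho> (radius L) \<zeta>))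
      else \<infinity>)"

definition ising_prob ::
  "ereal \<Rightarrow> real \<Rightarrow> (nat \<Rightarrow> 'r \<Rightarrow> int ^ 'd \<Rightarrow> int ^ 'd \<Rightarrow> bool) \<Rightarrow> (nat \<Rightarrow> real) \<Rightarrow> (nat \<Rightarrow> real) \<Rightarrow>
   'r local_sentence \<Rightarrow> nat \<Rightarrow> real" where
  "ising_prob p \<rho> I a b L n =
     measure (ising_measure p \<rho> n (a n) (b n)) {\<eta> \<in> configs n. models p \<rho> I n \<eta> L}"

end

theory Submission
  imports Defs
begin

text \<open>Paths of the torus lift to paths of the lattice \<open>\<int>\<^sup>d\<close>, so every ball of an admissible torus is
  the image of the lattice ball, and whether \<open>\<psi>\<^sub>i\<close> holds at \<open>x\<close> depends only on the local configuration
  around \<open>x\<close>. Changing a configuration on a single ball multiplies its weight by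
  \<open>exp (2 * a n * j)\<close>, where \<open>j\<close> is the change of the number of \<open>+1\<close>'s, up to a factor that is bounded
  because the degrees and \<open>b n\<close> are. Hence a ball has at least \<open>k\<close> \<open>+1\<close>'s with probability
  \<open>O (exp (2 * a n * k))\<close>, and a union bound over the \<open>n ^ d\<close> centres gives the limit 0. Conversely a
  given local configuration with at most \<open>k\<close> \<open>+1\<close>'s appears with conditional probability at least
  \<open>\<delta> = c * exp (2 * a n * k)\<close> in each of order \<open>n ^ d\<close> disjoint balls, whatever happens outside the
  ball, so it is missed with probability at most \<open>exp (- \<delta> * n ^ d)\<close> up to constants. The case \<open>k = 0\<close>
  is included, since there \<open>\<delta>\<close> is bounded below.\<close>

section \<open>Balls of the torus\<close>

text \<open>All later arguments against wrap-around reduce to this: congruent coordinates coincide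
  once their difference is shown to be smaller than \<open>n\<close>.\<close>

lemma int_mod_eq_imp_eq:
  fixes a b m :: int
  assumes "a mod m = b mod m" "\<bar>a - b\<bar> < m"
  shows "a = b"
proof -
  have "m dvd a - b" using assms(1) by (simp add: mod_eq_dvd_iff)
  then show ?thesis using assms(2) dvd_imp_le_int[of "a - b" m] by fastforce
qed

text \<open>One summand is at most the whole sum, and the powers q and 1/q cancel. This confines
  neighbours to a box whatever \<open>p\<close> is.\<close>

lemma component_le_lp_norm:
  assumes "1 \<le> p"
  shows "\<bar>v $ i\<bar> \<le> lp_norm p v"
proof (cases "p = \<infinity>")
  case True
  then show ?thesis by (simp add: lp_norm_def component_le_infnorm_cart)
next
  case False
  with assms obtain q where q: "p = ereal q" "q \<ge> 1"
    by (cases p) auto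
  have "\<bar>v $ i\<bar> = (\<bar>v $ i\<bar> powr q) powr (1 / q)" using q by (simp add: powr_powr)
  also have "\<dots> \<le> (\<Sum>i\<in>UNIV. \<bar>v $ i\<bar> powr q) powr (1 / q)"
    using q by (intro powr_mono2 member_le_sum) auto
  finally show ?thesis using q by (simp add: lp_norm_def)
qed

lemma lp_norm_cong_abs:
  assumes "\<And>i. \<bar>v $ i\<bar> = \<bar>w $ i\<bar>"
  shows "lp_norm p v = lp_norm p w"
  using assms by (simp add: lp_norm_def infnorm_cart)

text \<open>The witness is the representative nearest to 0: either \<open>k mod n\<close> or the
  negative of \<open>(- k) mod n\<close>.\<close>

lemma circ_abs_lift:
  assumes "n > 0"
  obtains w where "\<bar>w\<bar> = circ_abs n k" "w mod int n = k mod int n"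
proof (cases "k mod int n \<le> (- k) mod int n")
  case True
  show ?thesis by (rule that[of "k mod int n"]) (use True assms in \<open>auto simp: circ_abs_def\<close>)
next
  case False
  show ?thesis
    by (rule that[of "- ((- k) mod int n)"])
      (use False assms in \<open>auto simp: circ_abs_def mod_minus_eq\<close>)
qed

text \<open>Two representatives that are both below n/2 in absolute value differ by less than
  \<open>n\<close>, hence agree.\<close>

lemma circ_abs_small:
  assumes "2 * \<bar>w\<bar> < int n"
  shows "circ_abs n w = \<bar>w\<bar>"
proof -
  have n: "n > 0" using assms by linarith
  have "circ_abs n w \<le> \<bar>w\<bar>"
  proof (cases "w \<ge> 0")
    case True then show ?thesis using assms by (simp add: circ_abs_def)
  next
    case False then show ?thesis using assms by (simp add: circ_abs_def)
  qed
  moreover obtain w' where w': "\<bar>w'\<bar> = circ_abs n w" "w' mod int n = w mod int n"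
    using circ_abs_lift n by blast
  ultimately have "w' = w" using assms by (intro int_mod_eq_imp_eq[OF w'(2)]) linarith
  then show ?thesis using w' by simp
qed

lemma circ_abs_mod: "x mod int n = y mod int n \<Longrightarrow> circ_abs n x = circ_abs n y"
  by (simp add: circ_abs_def) (metis mod_minus_eq)

lemma torus_mod_in_vertices: "n > 0 \<Longrightarrow> torus_mod n x \<in> torus_vertices n"
  by (simp add: torus_mod_def torus_vertices_def)

lemma torus_mod_vertex: "x \<in> torus_vertices n \<Longrightarrow> torus_mod n x = x"
  by (simp add: torus_mod_def torus_vertices_def vec_eq_iff)

lemma torus_vertices_pos: "x \<in> torus_vertices n \<Longrightarrow> n > 0"
  by (force simp: torus_vertices_def)

lemma torus_mod_eq_iff: "torus_mod n x = torus_mod n y \<longleftrightarrow> (\<forall>i. x $ i mod int n = y $ i mod int n)"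
  by (simp add: torus_mod_def vec_eq_iff)

lemma torus_mod_add_left: "torus_mod n (torus_mod n x + y) = torus_mod n (x + y)"
  by (simp add: torus_mod_def vec_eq_iff mod_add_left_eq)

lemma torus_mod_add_right: "torus_mod n (x + torus_mod n y) = torus_mod n (x + y)"
  by (simp add: torus_mod_def vec_eq_iff mod_add_right_eq)

lemma torus_mod_add_eq: "torus_mod n (torus_mod n x + torus_mod n y) = torus_mod n (x + y)"
  by (simp add: torus_mod_add_left torus_mod_add_right)

lemma vec_box:
  fixes S :: "'a set"
  shows "{x :: 'a ^ 'd. \<forall>i. x $ i \<in> S} = vec_lambda ` (UNIV \<rightarrow>\<^sub>E S)"
proof (intro equalityI subsetI)
  fix x :: "'a ^ 'd" assume "x \<in> {x. \<forall>i. x $ i \<in> S}"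
  then have "vec_nth x \<in> UNIV \<rightarrow>\<^sub>E S" by auto
  then show "x \<in> vec_lambda ` (UNIV \<rightarrow>\<^sub>E S)" by (metis image_eqI vec_nth_inverse)
qed auto

lemma finite_vec_box: "finite S \<Longrightarrow> finite {x :: 'a ^ 'd. \<forall>i. x $ i \<in> S}"
  unfolding vec_box by (intro finite_imageI finite_PiE) auto

lemma card_vec_box: "card {x :: 'a ^ 'd. \<forall>i. x $ i \<in> S} = card S ^ CARD('d)"
  unfolding vec_box by (subst card_image) (auto simp: inj_on_def vec_lambda_inject card_PiE)

lemma torus_vertices_box: "torus_vertices n = {x :: int ^ 'd. \<forall>i. x $ i \<in> {0..<int n}}"
  by (auto simp: torus_vertices_def)

lemma finite_torus_vertices [simp]: "finite (torus_vertices n :: (int ^ 'd) set)"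
  unfolding torus_vertices_box by (rule finite_vec_box) simp

lemma card_torus_vertices: "card (torus_vertices n :: (int ^ 'd) set) = n ^ CARD('d)"
  unfolding torus_vertices_box by (subst card_vec_box) simp

section \<open>Lifting steps and paths from the torus to the lattice, and projecting them
  back\<close>

text \<open>A finite box containing every lattice neighbour of 0. Its cardinality bounds the degrees
  of all tori, independently of \<open>n\<close>.\<close>

definition steps :: "real \<Rightarrow> (int ^ 'd) set" where
  "steps \<rho> = {w. \<forall>i. \<bar>real_of_int (w $ i)\<bar> \<le> \<rho>}"

lemma finite_steps [simp]: "finite (steps \<rho> :: (int ^ 'd) set)"
proof -
  have "steps \<rho> \<subseteq> {w :: int ^ 'd. \<forall>i. w $ i \<in> {- \<lceil>\<rho>\<rceil>..\<lceil>\<rho>\<rceil>}}"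
  proof (clarsimp simp: steps_def)
    fix w :: "int ^ 'd" and i
    assume "\<forall>i. \<bar>real_of_int (w $ i)\<bar> \<le> \<rho>"
    then have "\<bar>real_of_int (w $ i)\<bar> \<le> \<rho>" by blast
    then show "- \<lceil>\<rho>\<rceil> \<le> w $ i \<and> w $ i \<le> \<lceil>\<rho>\<rceil>" by linarith
  qed
  then show ?thesis using finite_vec_box finite_subset by blast
qed

lemma lattice_adj_steps:
  assumes "1 \<le> p" "lattice_adj p \<rho> x y"
  shows "y - x \<in> steps \<rho>"
  unfolding steps_def
proof safe
  fix i
  show "\<bar>real_of_int ((y - x) $ i)\<bar> \<le> \<rho>"
    using component_le_lp_norm[OF assms(1), of "\<chi> i. real_of_int (y $ i - x $ i)" i] assms(2)
    by (simp add: lattice_adj_def)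
qed

lemma lattice_adj_translate: "lattice_adj p \<rho> (u + x) (u + y) \<longleftrightarrow> lattice_adj p \<rho> x y"
  by (simp add: lattice_adj_def)

text \<open>The nearest representative is chosen in each coordinate. The norm sees only absolute
  values, so it is the same for the lifted step.\<close>

lemma torus_adj_lift:
  assumes "torus_adj p \<rho> n x y"
  obtains w where "lattice_adj p \<rho> 0 w" "y = torus_mod n (x + w)"
proof -
  have xy: "x \<in> torus_vertices n" "y \<in> torus_vertices n" "x \<noteq> y" using assms by (auto simp: torus_adj_def)
  have n: "n > 0" using xy torus_vertices_pos by blast
  have "\<forall>i. \<exists>w. \<bar>w\<bar> = circ_abs n (y $ i - x $ i) \<and> w mod int n = (y $ i - x $ i) mod int n"
    using circ_abs_lift[OF n] by metis
  then obtain f where f: "\<And>i. \<bar>f i\<bar> = circ_abs n (y $ i - x $ i)"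
      "\<And>i. f i mod int n = (y $ i - x $ i) mod int n" by metis
  define w :: "int ^ 'a" where "w = (\<chi> i. f i)"
  have "torus_mod n (x + w) = torus_mod n y"
    unfolding torus_mod_eq_iff w_def using f(2)
    by (simp, metis (no_types) add.commute diff_add_cancel mod_add_left_eq)
  then have y: "y = torus_mod n (x + w)" using torus_mod_vertex[OF xy(2)] by simp
  have "lp_norm p (\<chi> i. real_of_int (w $ i)) = lp_norm p (\<chi> i. real_of_int (circ_abs n (y $ i - x $ i)))"
    by (rule lp_norm_cong_abs) (simp add: w_def flip: f(1))
  moreover have "w \<noteq> 0" using y xy torus_mod_vertex by force
  ultimately have "lattice_adj p \<rho> 0 w" using assms by (simp add: lattice_adj_def torus_adj_def)
  then show ?thesis using that y by blast
qed

text \<open>Since 2\<rho> < n, every coordinate of \<open>w\<close> is already the nearest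
  representative of its class, and a nonzero \<open>w\<close> stays nonzero modulo
  \<open>n\<close>.\<close>

lemma torus_adjI:
  assumes "1 \<le> p" "x \<in> torus_vertices n" "lattice_adj p \<rho> 0 w" "2 * \<rho> < real n"
  shows "torus_adj p \<rho> n x (torus_mod n (x + w))"
proof -
  let ?y = "torus_mod n (x + w)"
  have n: "n > 0" using assms torus_vertices_pos by blast
  have w: "\<bar>real_of_int (w $ i)\<bar> \<le> \<rho>" for i
    using lattice_adj_steps[OF assms(1,3)] by (simp add: steps_def)
  have w2: "2 * \<bar>w $ i\<bar> < int n" for i using w[of i] assms(4) by linarith
  have "circ_abs n (?y $ i - x $ i) = \<bar>w $ i\<bar>" for i
  proof -
    have "circ_abs n (?y $ i - x $ i) = circ_abs n (w $ i)"
      by (rule circ_abs_mod) (simp add: torus_mod_def mod_diff_left_eq)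
    then show ?thesis using circ_abs_small[OF w2] by simp
  qed
  then have "lp_norm p (\<chi> i. real_of_int (circ_abs n (?y $ i - x $ i))) = lp_norm p (\<chi> i. real_of_int (w $ i))"
    by (intro lp_norm_cong_abs) simp
  moreover have "x \<noteq> ?y"
  proof
    assume "x = ?y"
    then have *: "torus_mod n (x + 0) = torus_mod n (x + w)" using torus_mod_vertex[OF assms(2)] by simp
    have "w $ i = 0" for i
    proof -
      have "(x $ i) mod int n = (x $ i + w $ i) mod int n" using * by (simp add: torus_mod_eq_iff)
      moreover have "\<bar>x $ i - (x $ i + w $ i)\<bar> < int n" using w2[of i] by simp
      ultimately have "x $ i = x $ i + w $ i" by (rule int_mod_eq_imp_eq)
      then show ?thesis by simp
    qed
    then show False using assms(3) by (simp add: lattice_adj_def vec_eq_iff)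
  qed
  ultimately show ?thesis using assms torus_mod_in_vertices[OF n] by (simp add: torus_adj_def lattice_adj_def)
qed

text \<open>Each step moves a coordinate by at most \<rho>. Writing \<open>max \<rho> 0\<close>
  keeps the bound monotone in \<open>k\<close> when \<rho> is negative.\<close>

lemma lattice_path_bound:
  assumes "1 \<le> p"
  shows "(lattice_adj p \<rho> ^^ k) x y \<Longrightarrow> \<bar>real_of_int (y $ i - x $ i)\<bar> \<le> real k * max \<rho> 0"
proof (induction k arbitrary: y)
  case (Suc k)
  then obtain z where z: "(lattice_adj p \<rho> ^^ k) x z" "lattice_adj p \<rho> z y" by (metis relpowp_Suc_E)
  have "\<bar>real_of_int (y $ i - z $ i)\<bar> \<le> \<rho>"
    using lattice_adj_steps[OF assms z(2)] by (simp add: steps_def)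
  moreover have "real (Suc k) * max \<rho> 0 = real k * max \<rho> 0 + max \<rho> 0" by (simp add: algebra_simps)
  ultimately show ?case using Suc.IH[OF z(1)] by linarith
qed simp

text \<open>Path lifting for the covering of the torus by the lattice: the lifted steps are added up
  one after the other.\<close>

lemma torus_path_lift:
  assumes "(torus_adj p \<rho> n ^^ k) x y" "x \<in> torus_vertices n"
  shows "\<exists>w. (lattice_adj p \<rho> ^^ k) 0 w \<and> y = torus_mod n (x + w)"
  using assms
proof (induction k arbitrary: y)
  case 0
  then show ?case using torus_mod_vertex[of x n] by (intro exI[of _ 0]) auto
next
  case (Suc k)
  then obtain z where z: "(torus_adj p \<rho> n ^^ k) x z" "torus_adj p \<rho> n z y" by (metis relpowp_Suc_E)
  obtain w where w: "(lattice_adj p \<rho> ^^ k) 0 w" "z = torus_mod n (x + w)" using Suc z by blast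
  obtain w' where w': "lattice_adj p \<rho> 0 w'" "y = torus_mod n (z + w')" using torus_adj_lift[OF z(2)] .
  have "lattice_adj p \<rho> w (w + w')" using lattice_adj_translate[of p \<rho> w 0 w'] w'(1) by simp
  then have "(lattice_adj p \<rho> ^^ Suc k) 0 (w + w')" using w(1) by (meson relpowp_Suc_I)
  moreover have "y = torus_mod n (x + (w + w'))" using w w' by (simp add: torus_mod_add_left add.assoc)
  ultimately show ?case by blast
qed

lemma torus_path_project:
  assumes "1 \<le> p" "x \<in> torus_vertices n" "2 * \<rho> < real n" "(lattice_adj p \<rho> ^^ k) 0 w"
  shows "(torus_adj p \<rho> n ^^ k) x (torus_mod n (x + w))"
  using assms(4)
proof (induction k arbitrary: w)
  case 0
  then show ?case using torus_mod_vertex[OF assms(2)] by simp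
next
  case (Suc k)
  then obtain z where z: "(lattice_adj p \<rho> ^^ k) 0 z" "lattice_adj p \<rho> z w" by (metis relpowp_Suc_E)
  have n: "n > 0" using assms torus_vertices_pos by blast
  have "lattice_adj p \<rho> 0 (w - z)" using lattice_adj_translate[of p \<rho> z 0 "w - z"] z(2) by simp
  from torus_adjI[OF assms(1) torus_mod_in_vertices[OF n, of "x + z"] this assms(3)]
  have "torus_adj p \<rho> n (torus_mod n (x + z)) (torus_mod n (x + w))" by (simp add: torus_mod_add_left)
  then show ?case using Suc.IH[OF z(1)] by (meson relpowp_Suc_I)
qed

section \<open>Balls as images of the lattice ball\<close>

lemma graph_dist_le_iff: "graph_dist E x y \<le> enat r \<longleftrightarrow> (\<exists>k\<le>r. (E ^^ k) x y)"
proof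
  assume *: "graph_dist E x y \<le> enat r"
  let ?K = "{k. (E ^^ k) x y}"
  \<comment> \<open>Without any path the infimum would be \<infinity>; a nonempty set of extended
    naturals attains its infimum.\<close>
  have ne: "enat ` ?K \<noteq> {}"
    using * by (auto simp: graph_dist_def Inf_enat_def split: if_splits)
  have "graph_dist E x y \<in> enat ` ?K"
    unfolding graph_dist_def using ne by (metis (no_types, lifting) Inf_enat_def LeastI_ex ex_in_conv)
  then show "\<exists>k\<le>r. (E ^^ k) x y" using * by auto
next
  assume "\<exists>k\<le>r. (E ^^ k) x y"
  then obtain k where "k \<le> r" "(E ^^ k) x y" by blast
  then show "graph_dist E x y \<le> enat r"
    unfolding graph_dist_def by (intro INF_lower2[of k]) auto
qed

lemma lattice_ball_iff: "z \<in> lattice_ball p \<rho> r \<longleftrightarrow> (\<exists>k\<le>r. (lattice_adj p \<rho> ^^ k) 0 z)"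
  by (simp add: lattice_ball_def graph_dist_le_iff)

lemma lattice_ball_bound:
  assumes "1 \<le> p" "z \<in> lattice_ball p \<rho> r"
  shows "\<bar>real_of_int (z $ i)\<bar> \<le> real r * max \<rho> 0"
proof -
  obtain k where k: "k \<le> r" "(lattice_adj p \<rho> ^^ k) 0 z" using assms(2) by (auto simp: lattice_ball_iff)
  have "\<bar>real_of_int (z $ i)\<bar> \<le> real k * max \<rho> 0" using lattice_path_bound[OF assms(1) k(2), of i] by simp
  also have "\<dots> \<le> real r * max \<rho> 0" using k(1) by (intro mult_right_mono) auto
  finally show ?thesis .
qed

lemma finite_lattice_ball: "1 \<le> p \<Longrightarrow> finite (lattice_ball p \<rho> r)"
  by (rule finite_subset[OF _ finite_steps[of "real r * max \<rho> 0"]])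
    (auto simp: steps_def lattice_ball_bound)

lemma zero_in_lattice_ball: "0 \<in> lattice_ball p \<rho> r"
  by (auto simp: lattice_ball_iff intro: exI[of _ 0])

text \<open>For negative \<rho> even \<open>n = 0\<close> is \<open>admissible\<close>, hence the
  separate assumption \<open>n > 0\<close>.\<close>

lemma admissible_max:
  assumes "admissible \<rho> r n" "n > 0"
  shows "2 * max \<rho> 0 * (real r + 1) < real n"
  using assms by (auto simp: admissible_def max_def)

lemma admissible_radius0:
  assumes "admissible \<rho> r n" "n > 0"
  shows "2 * \<rho> < real n"
proof -
  have "2 * \<rho> \<le> 2 * max \<rho> 0 * 1" by simp
  also have "\<dots> \<le> 2 * max \<rho> 0 * (real r + 1)" by (intro mult_left_mono) auto
  finally show ?thesis using admissible_max[OF assms] by linarith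
qed

lemma torus_ball_eq_image:
  assumes "1 \<le> p" "admissible \<rho> r n" "x \<in> torus_vertices n"
  shows "torus_ball p \<rho> n x r = (\<lambda>z. torus_mod n (x + z)) ` lattice_ball p \<rho> r"
proof -
  have n: "n > 0" using assms torus_vertices_pos by blast
  show ?thesis
  proof (intro equalityI subsetI)
    fix y assume "y \<in> torus_ball p \<rho> n x r"
    then obtain k where "k \<le> r" "(torus_adj p \<rho> n ^^ k) x y" by (auto simp: torus_ball_def graph_dist_le_iff)
    then show "y \<in> (\<lambda>z. torus_mod n (x + z)) ` lattice_ball p \<rho> r"
      using torus_path_lift[OF _ assms(3), where p = p and \<rho> = \<rho> and k = k and y = y] by (force simp: lattice_ball_iff image_iff)
  next
    fix y assume "y \<in> (\<lambda>z. torus_mod n (x + z)) ` lattice_ball p \<rho> r"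
    then obtain k z where "k \<le> r" "(lattice_adj p \<rho> ^^ k) 0 z" "y = torus_mod n (x + z)"
      by (auto simp: lattice_ball_iff)
    then show "y \<in> torus_ball p \<rho> n x r"
      using torus_path_project[OF assms(1,3) admissible_radius0[OF assms(2) n]] torus_mod_in_vertices[OF n]
      by (auto simp: torus_ball_def graph_dist_le_iff)
  qed
qed

lemma lattice_ball_diff_bound:
  assumes "1 \<le> p" "z \<in> lattice_ball p \<rho> r" "z' \<in> lattice_ball p \<rho> r"
  shows "\<bar>real_of_int (z' $ i - z $ i)\<bar> \<le> 2 * real r * max \<rho> 0"
  using lattice_ball_bound[OF assms(1,2), of i] lattice_ball_bound[OF assms(1,3), of i] by simp

text \<open>Two points of the lattice ball differ in each coordinate by at most twice its radius
  times \<rho>, which is below \<open>n\<close>.\<close>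

lemma inj_on_torus_mod_ball:
  assumes "1 \<le> p" "admissible \<rho> r n" "n > 0"
  shows "inj_on (\<lambda>z. torus_mod n (x + z)) (lattice_ball p \<rho> r)"
proof (rule inj_onI)
  fix z z' assume z: "z \<in> lattice_ball p \<rho> r" "z' \<in> lattice_ball p \<rho> r"
    and eq: "torus_mod n (x + z) = torus_mod n (x + z')"
  have "z $ i = z' $ i" for i
  proof -
    have "(x $ i + z $ i) mod int n = (x $ i + z' $ i) mod int n" using eq by (simp add: torus_mod_eq_iff)
    moreover have "\<bar>real_of_int (z $ i - z' $ i)\<bar> < real n"
      using lattice_ball_diff_bound[OF assms(1) z(2,1), of i] admissible_max[OF assms(2,3)]
      by (simp add: algebra_simps)
    then have "\<bar>(x $ i + z $ i) - (x $ i + z' $ i)\<bar> < int n" by linarith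
    ultimately have "x $ i + z $ i = x $ i + z' $ i" by (rule int_mod_eq_imp_eq)
    then show ?thesis by simp
  qed
  then show "z = z'" by (simp add: vec_eq_iff)
qed

section \<open>Local formulas depend only on the local configuration\<close>

text \<open>Invariance of first-order truth under isomorphism. The assignment must lie in the domain
  at every variable, as the constant assignment of \<open>sat_local\<close> does.\<close>

lemma sat_iso:
  assumes "inj_on h D" "\<And>R u v. u \<in> D \<Longrightarrow> v \<in> D \<Longrightarrow> I' R (h u) (h v) \<longleftrightarrow> I R u v"
    and "\<And>u. u \<in> D \<Longrightarrow> C' (h u) \<longleftrightarrow> C u" and "\<And>u. \<sigma> u \<in> D"
  shows "sat (h ` D) I' C' (h \<circ> \<sigma>) \<psi> \<longleftrightarrow> sat D I C \<sigma> \<psi>"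
  using assms(4)
proof (induction \<psi> arbitrary: \<sigma>)
  case (Eq u v)
  then show ?case using assms(1) by (auto dest: inj_onD)
next
  case (Exi u A)
  have upd: "(h \<circ> \<sigma>)(u := h v) = h \<circ> \<sigma>(u := v)" for v by auto
  have "sat (h ` D) I' C' ((h \<circ> \<sigma>)(u := h v)) A \<longleftrightarrow> sat D I C (\<sigma>(u := v)) A" if "v \<in> D" for v
    unfolding upd using that Exi.prems by (intro Exi.IH) auto
  then show ?case by (simp add: o_def)
next
  case (Uni u A)
  have upd: "(h \<circ> \<sigma>)(u := h v) = h \<circ> \<sigma>(u := v)" for v by auto
  have "sat (h ` D) I' C' ((h \<circ> \<sigma>)(u := h v)) A \<longleftrightarrow> sat D I C (\<sigma>(u := v)) A" if "v \<in> D" for v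
    unfolding upd using that Uni.prems by (intro Uni.IH) auto
  then show ?case by (simp add: o_def)
qed (use assms in auto)

text \<open>Translation by \<open>x + z\<close> carries the pair (0, z' - z) to the pair (x + z, x +
  z').\<close>

lemma interpretation_translate:
  assumes "torus_interpretation p \<rho> I" "n > 0"
  shows "I n R (torus_mod n (x + z)) (torus_mod n (x + z')) \<longleftrightarrow> I n R 0 (torus_mod n (z' - z))"
proof -
  have "I n R (torus_mod n (u + t)) (torus_mod n (v + t)) \<longleftrightarrow> I n R u v"
    if "u \<in> torus_vertices n" "v \<in> torus_vertices n" "t \<in> torus_vertices n" for u v t
    using assms(1) that unfolding torus_interpretation_def by blast
  moreover have "0 \<in> torus_vertices n" using assms(2) by (simp add: torus_vertices_def)
  ultimately have "I n R (torus_mod n (0 + torus_mod n (x + z))) (torus_mod n (torus_mod n (z' - z) + torus_mod n (x + z)))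
      \<longleftrightarrow> I n R 0 (torus_mod n (z' - z))"
    using torus_mod_in_vertices[OF assms(2)] by blast
  moreover have "torus_mod n (0 + torus_mod n (x + z)) = torus_mod n (x + z)"
    using torus_mod_add_right[of n 0 "x + z"] by simp
  moreover have "torus_mod n (torus_mod n (z' - z) + torus_mod n (x + z)) = torus_mod n (x + z')"
    by (simp only: torus_mod_add_eq) (simp add: algebra_simps)
  ultimately show ?thesis by simp
qed

text \<open>A relation that holds between distinct vertices forces them to be adjacent. Within a ball of an
  admissible torus this bounds the difference of the two representatives by \<open>\<rho>\<close> in each
  coordinate, so that the comparison of different \<open>n\<close> applies.\<close>

lemma interpretation_size_imp:
  assumes "1 \<le> p" "torus_interpretation p \<rho> I"
    and n: "admissible \<rho> r n" "n > 0" and n': "admissible \<rho> r n'" "n' > 0"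
    and z: "z \<in> lattice_ball p \<rho> r" "z' \<in> lattice_ball p \<rho> r"
    and rel: "I n R 0 (torus_mod n (z' - z))"
  shows "I n' R 0 (torus_mod n' (z' - z))"
proof -
  let ?w = "z' - z"
  have comp: "I n R 0 (torus_mod n t) \<longleftrightarrow> I n' R 0 (torus_mod n' t)"
    if "\<forall>i. 2 * \<bar>t $ i\<bar> < int n \<and> 2 * \<bar>t $ i\<bar> < int n'" for t
    using assms(2) admissible_radius0[OF n] admissible_radius0[OF n'] that
    unfolding torus_interpretation_def by blast
  have "\<forall>i. 2 * \<bar>?w $ i\<bar> < int n \<and> 2 * \<bar>?w $ i\<bar> < int n'"
  proof (cases "torus_mod n ?w = 0")
    \<comment> \<open>A difference of two ball points that vanishes modulo \<open>n\<close> is 0, so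
      both size conditions are trivial.\<close>
    case True
    have "?w $ i = 0" for i
    proof (rule int_mod_eq_imp_eq[of _ "int n"])
      show "?w $ i mod int n = 0 mod int n" using True by (simp add: torus_mod_def vec_eq_iff)
      have "\<bar>real_of_int (?w $ i)\<bar> < real n"
        using lattice_ball_diff_bound[OF assms(1) z, of i] admissible_max[OF n]
        by (simp add: algebra_simps)
      then show "\<bar>?w $ i - 0\<bar> < int n" by linarith
    qed
    then show ?thesis using n n' by simp
  next
    case False
    have V: "0 \<in> torus_vertices n" "torus_mod n ?w \<in> torus_vertices n"
      using torus_mod_in_vertices[OF n(2)] n(2) by (auto simp: torus_vertices_def)
    then have "torus_adj p \<rho> n 0 (torus_mod n ?w)"
      using assms(2) rel False unfolding torus_interpretation_def by metis
    then obtain t where t: "lattice_adj p \<rho> 0 t" "torus_mod n ?w = torus_mod n t"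
      using torus_adj_lift by (metis add_0)
    have t\<rho>: "\<bar>real_of_int (t $ i)\<bar> \<le> \<rho>" for i
      using lattice_adj_steps[OF assms(1) t(1)] by (simp add: steps_def)
    have "?w $ i = t $ i" for i
    proof (rule int_mod_eq_imp_eq[of _ "int n"])
      show "?w $ i mod int n = t $ i mod int n" using t(2) by (simp add: torus_mod_eq_iff)
      \<comment> \<open>The margin built into \<open>admissible\<close> is spent here: the ball
        difference contributes at most 2r\<rho> and the step \<open>t\<close> at most \<rho>,
        together still below \<open>n\<close>.\<close>
      have "\<bar>real_of_int (?w $ i - t $ i)\<bar> < real n"
        using lattice_ball_diff_bound[OF assms(1) z, of i] admissible_max[OF n] t\<rho>[of i]
        by (simp add: algebra_simps)
      then show "\<bar>?w $ i - t $ i\<bar> < int n" by linarith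
    qed
    moreover have "2 * \<bar>t $ i\<bar> < int n \<and> 2 * \<bar>t $ i\<bar> < int n'" for i
      using t\<rho>[of i] admissible_radius0[OF n] admissible_radius0[OF n'] by linarith
    ultimately show ?thesis by simp
  qed
  then show ?thesis using comp rel by blast
qed

text \<open>Moves the question to a structure on the fixed lattice ball in which \<open>x\<close> no
  longer occurs and \<open>n\<close> enters only through the relations.\<close>

lemma sat_local_iff_lattice:
  assumes "1 \<le> p" "torus_interpretation p \<rho> I" "admissible \<rho> r n" "x \<in> torus_vertices n"
    and "describes p \<rho> n r \<zeta> x \<eta>"
  shows "sat_local p \<rho> I n \<eta> r \<psi> x \<longleftrightarrow>
    sat (lattice_ball p \<rho> r) (\<lambda>R z z'. I n R 0 (torus_mod n (z' - z))) (\<lambda>z. \<zeta> z = 1) (\<lambda>_. 0) \<psi>"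
proof -
  have n: "n > 0" using assms(4) torus_vertices_pos by blast
  let ?h = "\<lambda>z. torus_mod n (x + z)"
  have "sat (?h ` lattice_ball p \<rho> r) (I n) (\<lambda>v. \<eta> v = 1) (?h \<circ> (\<lambda>_. 0)) \<psi> \<longleftrightarrow>
    sat (lattice_ball p \<rho> r) (\<lambda>R z z'. I n R 0 (torus_mod n (z' - z))) (\<lambda>z. \<zeta> z = 1) (\<lambda>_. 0) \<psi>"
    using assms(5) zero_in_lattice_ball interpretation_translate[OF assms(2) n]
    by (intro sat_iso inj_on_torus_mod_ball assms n) (auto simp: describes_def)
  moreover have "?h \<circ> (\<lambda>_. 0) = (\<lambda>_ :: nat. x)" using torus_mod_vertex[OF assms(4)] by auto
  ultimately show ?thesis unfolding sat_local_def torus_ball_eq_image[OF assms(1,3,4)] by simp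
qed

text \<open>The restriction makes the view \<open>undefined\<close> off the lattice ball, as
  membership in \<open>local_configs\<close> requires.\<close>

definition local_view :: "ereal \<Rightarrow> real \<Rightarrow> nat \<Rightarrow> nat \<Rightarrow> int ^ 'd \<Rightarrow> (int ^ 'd \<Rightarrow> real) \<Rightarrow> int ^ 'd \<Rightarrow> real" where
  "local_view p \<rho> n r x \<eta> = (\<lambda>z\<in>lattice_ball p \<rho> r. \<eta> (torus_mod n (x + z)))"

lemma describes_local_view: "describes p \<rho> n r (local_view p \<rho> n r x \<eta>) x \<eta>"
  by (simp add: describes_def local_view_def)

text \<open>A view that satisfies the formula at one vertex of one admissible torus forces it
  wherever the view occurs, because all these balls are isomorphic as structures.\<close>

lemma local_view_implying:
  assumes "1 \<le> p" "torus_interpretation p \<rho> I" "admissible \<rho> r n" "x \<in> torus_vertices n"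
    and "\<eta> \<in> configs n" "sat_local p \<rho> I n \<eta> r \<psi> x"
  shows "local_view p \<rho> n r x \<eta> \<in> descriptions_implying p \<rho> I r \<psi>"
proof -
  let ?\<zeta> = "local_view p \<rho> n r x \<eta>"
  have n: "n > 0" using assms(4) torus_vertices_pos by blast
  have "?\<zeta> \<in> local_configs p \<rho> r"
    using assms(5) torus_mod_in_vertices[OF n] by (fastforce simp: local_configs_def local_view_def configs_def)
  moreover have "sat_local p \<rho> I n' \<eta>' r \<psi> x'"
    if *: "admissible \<rho> r n'" "x' \<in> torus_vertices n'" "describes p \<rho> n' r ?\<zeta> x' \<eta>'" for n' x' \<eta>'
  proof -
    have n': "n' > 0" using *(2) torus_vertices_pos by blast
    \<comment> \<open>\<open>sat_iso\<close> with the identity map: the relations coming from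
      \<open>n\<close> and \<open>n'\<close> agree on the lattice ball, one implication for each
      order of the two sizes.\<close>
    have "sat (id ` lattice_ball p \<rho> r) (\<lambda>R z z'. I n' R 0 (torus_mod n' (z' - z))) (\<lambda>z. ?\<zeta> z = 1) (id \<circ> (\<lambda>_. 0)) \<psi>
      \<longleftrightarrow> sat (lattice_ball p \<rho> r) (\<lambda>R z z'. I n R 0 (torus_mod n (z' - z))) (\<lambda>z. ?\<zeta> z = 1) (\<lambda>_. 0) \<psi>"
      using interpretation_size_imp[OF assms(1,2,3) n *(1) n'] interpretation_size_imp[OF assms(1,2) *(1) n' assms(3) n]
        zero_in_lattice_ball by (intro sat_iso) auto
    then show ?thesis
      using sat_local_iff_lattice[OF assms(1-4) describes_local_view] sat_local_iff_lattice[OF assms(1,2) *] assms(6)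
      by (simp add: comp_def)
  qed
  ultimately show ?thesis by (simp add: descriptions_implying_def)
qed

section \<open>Weights of configurations\<close>

lemma finite_configs [simp]: "finite (configs n :: (int ^ 'd \<Rightarrow> real) set)"
  by (simp add: configs_def finite_PiE)

lemma configs_values: "\<eta> \<in> configs n \<Longrightarrow> v \<in> torus_vertices n \<Longrightarrow> \<eta> v = -1 \<or> \<eta> v = 1"
  by (auto simp: configs_def PiE_iff)

lemma ising_weight_pos: "ising_weight p \<rho> n \<alpha> \<beta> \<eta> > 0"
  by (simp add: ising_weight_def)

lemma partition_pos: "(\<Sum>\<eta>\<in>(configs n :: (int ^ 'd \<Rightarrow> real) set). ising_weight p \<rho> n \<alpha> \<beta> \<eta>) > 0"
proof (rule sum_pos)
  show "(configs n :: (int ^ 'd \<Rightarrow> real) set) \<noteq> {}"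
    by (simp add: configs_def PiE_eq_empty_iff)
qed (auto simp: ising_weight_pos)

lemma ising_prob_eq:
  fixes I :: "nat \<Rightarrow> 'r \<Rightarrow> int ^ 'd \<Rightarrow> int ^ 'd \<Rightarrow> bool"
  shows "ising_prob p \<rho> I a b L n =
    (\<Sum>\<eta> | \<eta> \<in> configs n \<and> models p \<rho> I n \<eta> L. ising_weight p \<rho> n (a n) (b n) \<eta>) /
    (\<Sum>\<eta>\<in>(configs n :: (int ^ 'd \<Rightarrow> real) set). ising_weight p \<rho> n (a n) (b n) \<eta>)"
proof -
  let ?w = "ising_weight p \<rho> n (a n) (b n) :: (int ^ 'd \<Rightarrow> real) \<Rightarrow> real"
  let ?Z = "sum ?w (configs n)" and ?A = "{\<eta> \<in> configs n. models p \<rho> I n \<eta> L}"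
  have pos: "?w \<eta> / ?Z \<ge> 0" for \<eta>
    by (intro divide_nonneg_nonneg less_imp_le ising_weight_pos partition_pos)
  have "emeasure (ising_measure p \<rho> n (a n) (b n)) ?A = (\<Sum>\<eta>\<in>?A. ennreal (?w \<eta> / ?Z))"
    unfolding ising_measure_def Let_def by (subst emeasure_point_measure_finite) auto
  also have "\<dots> = ennreal (\<Sum>\<eta>\<in>?A. ?w \<eta> / ?Z)" using pos by (intro sum_ennreal) auto
  also have "(\<Sum>\<eta>\<in>?A. ?w \<eta> / ?Z) = sum ?w ?A / ?Z" by (simp only: sum_divide_distrib)
  finally have "emeasure (ising_measure p \<rho> n (a n) (b n)) ?A = ennreal (sum ?w ?A / ?Z)" .
  moreover have "sum ?w ?A / ?Z \<ge> 0"
    by (intro divide_nonneg_nonneg sum_nonneg less_imp_le ising_weight_pos)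
  ultimately show ?thesis unfolding ising_prob_def measure_def by simp
qed

section \<open>Change of the weight under a local modification\<close>

lemma card_torus_edges_meeting_le:
  fixes B :: "(int ^ 'd) set"
  assumes "1 \<le> p" "finite B"
  shows "card {e \<in> torus_edges p \<rho> n. e \<inter> B \<noteq> {}} \<le> card B * card (steps \<rho> :: (int ^ 'd) set)"
proof -
  let ?f = "\<lambda>(x, w). {x, torus_mod n (x + w)}"
  have sub: "{e \<in> torus_edges p \<rho> n. e \<inter> B \<noteq> {}} \<subseteq> ?f ` (B \<times> steps \<rho>)"
  proof
    fix e assume "e \<in> {e \<in> torus_edges p \<rho> n. e \<inter> B \<noteq> {}}"
    then obtain x where e: "e \<in> torus_edges p \<rho> n" and x: "x \<in> e" "x \<in> B" by blast
    obtain u v where uv: "e = {u, v}" "torus_adj p \<rho> n u v" using e by (auto simp: torus_edges_def)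
    \<comment> \<open>Adjacency is symmetric because \<open>circ_abs\<close> is even, so the edge
      can be read as starting at its endpoint in \<open>B\<close>.\<close>
    have "circ_abs n (u $ i - v $ i) = circ_abs n (v $ i - u $ i)" for i
      by (simp add: circ_abs_def min.commute)
    then have "torus_adj p \<rho> n v u" using uv(2) by (auto simp: torus_adj_def)
    then obtain y where y: "e = {x, y}" "torus_adj p \<rho> n x y" using uv x(1) by blast
    obtain w where w: "lattice_adj p \<rho> 0 w" "y = torus_mod n (x + w)" using torus_adj_lift[OF y(2)] .
    have "w \<in> steps \<rho>" using lattice_adj_steps[OF assms(1) w(1)] by simp
    then show "e \<in> ?f ` (B \<times> steps \<rho>)" using y w x by (intro image_eqI[of _ _ "(x, w)"]) auto
  qed
  have fin: "finite (B \<times> (steps \<rho> :: (int ^ 'd) set))" using assms by simp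
  show "card {e \<in> torus_edges p \<rho> n. e \<inter> B \<noteq> {}} \<le> card B * card (steps \<rho> :: (int ^ 'd) set)"
    using surj_card_le[OF fin sub] by (simp add: card_cartesian_product)
qed

lemma finite_torus_edges [simp]: "finite (torus_edges p \<rho> n)"
  by (rule finite_subset[of _ "Pow (torus_vertices n)"]) (auto simp: torus_edges_def torus_adj_def)

lemma abs_prod_edge:
  assumes "\<eta> \<in> configs n" "e \<in> torus_edges p \<rho> n"
  shows "\<bar>\<Prod>v\<in>e. \<eta> v\<bar> = 1"
proof -
  have "\<bar>\<eta> v\<bar> = 1" if "v \<in> e" for v
  proof -
    have "v \<in> torus_vertices n" using that assms(2) by (auto simp: torus_edges_def torus_adj_def)
    then show ?thesis using configs_values[OF assms(1)] by fastforce
  qed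
  then show ?thesis unfolding abs_prod by simp
qed

text \<open>Vertex terms off \<open>B\<close> cancel, and so do edges missing \<open>B\<close>. Each
  remaining edge product changes by at most 2, and \<open>b0\<close> bounds the pair
  potential.\<close>

lemma ising_weight_ratio:
  fixes B :: "(int ^ 'd) set"
  assumes "1 \<le> p" "\<eta> \<in> configs n" "\<xi> \<in> configs n" "B \<subseteq> torus_vertices n"
    and eq: "\<And>v. v \<notin> B \<Longrightarrow> \<eta> v = \<xi> v" and "\<bar>\<beta>\<bar> \<le> b0"
  shows "ising_weight p \<rho> n \<alpha> \<beta> \<eta> \<le>
    exp (\<alpha> * ((\<Sum>v\<in>B. \<eta> v) - (\<Sum>v\<in>B. \<xi> v)) + 2 * b0 * card B * card (steps \<rho> :: (int ^ 'd) set))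
      * ising_weight p \<rho> n \<alpha> \<beta> \<xi>"
proof -
  let ?V = "torus_vertices n :: (int ^ 'd) set" and ?E = "torus_edges p \<rho> n :: (int ^ 'd) set set"
  let ?K = "card (steps \<rho> :: (int ^ 'd) set)" and ?EB = "{e \<in> torus_edges p \<rho> n. e \<inter> B \<noteq> {}}"
  have finB: "finite B" using finite_subset[OF assms(4) finite_torus_vertices] .
  have "(\<Sum>v\<in>?V. \<eta> v) - (\<Sum>v\<in>?V. \<xi> v) = (\<Sum>v\<in>?V. \<eta> v - \<xi> v)" by (simp add: sum_subtractf)
  also have "\<dots> = (\<Sum>v\<in>B. \<eta> v - \<xi> v)" using assms(4) eq by (intro sum.mono_neutral_right) auto
  finally have V: "(\<Sum>v\<in>?V. \<eta> v) - (\<Sum>v\<in>?V. \<xi> v) = (\<Sum>v\<in>B. \<eta> v) - (\<Sum>v\<in>B. \<xi> v)"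
    by (simp add: sum_subtractf)
  let ?d = "\<lambda>e. (\<Prod>v\<in>e. \<eta> v) - (\<Prod>v\<in>e. \<xi> v)"
  have "(\<Sum>e\<in>?E. ?d e) = (\<Sum>e\<in>?EB. ?d e)"
  proof (intro sum.mono_neutral_right ballI)
    fix e assume "e \<in> ?E - ?EB"
    then have "(\<Prod>v\<in>e. \<eta> v) = (\<Prod>v\<in>e. \<xi> v)" by (intro prod.cong refl eq) auto
    then show "?d e = 0" by simp
  qed auto
  also have "\<bar>\<dots>\<bar> \<le> (\<Sum>e\<in>?EB. \<bar>?d e\<bar>)" by (rule sum_abs)
  also have "\<dots> \<le> (\<Sum>e\<in>?EB. 2)"
  proof (rule sum_mono)
    fix e assume "e \<in> ?EB"
    then show "\<bar>?d e\<bar> \<le> 2" using abs_prod_edge[OF assms(2), of e p \<rho>] abs_prod_edge[OF assms(3), of e p \<rho>] by auto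
  qed
  also have "\<dots> = 2 * real (card ?EB)" by simp
  also have "\<dots> \<le> 2 * real (card B * ?K)"
    using card_torus_edges_meeting_le[OF assms(1) finB, of \<rho> n] by (simp only: of_nat_le_iff mult_le_cancel_left_pos zero_less_numeral)
  finally have d: "\<bar>\<Sum>e\<in>?E. ?d e\<bar> \<le> 2 * (card B * ?K)" by simp
  have "\<beta> * (\<Sum>e\<in>?E. ?d e) \<le> \<bar>\<beta>\<bar> * \<bar>\<Sum>e\<in>?E. ?d e\<bar>" by (metis abs_ge_self abs_mult)
  also have "\<dots> \<le> b0 * (2 * (card B * ?K))" using assms(6) d by (intro mult_mono) auto
  finally have E: "\<beta> * (\<Sum>e\<in>?E. \<Prod>v\<in>e. \<eta> v) \<le> \<beta> * (\<Sum>e\<in>?E. \<Prod>v\<in>e. \<xi> v) + 2 * b0 * card B * ?K"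
    by (simp add: sum_subtractf algebra_simps)
  have "\<alpha> * (\<Sum>v\<in>?V. \<eta> v) = \<alpha> * (\<Sum>v\<in>?V. \<xi> v) + \<alpha> * ((\<Sum>v\<in>B. \<eta> v) - (\<Sum>v\<in>B. \<xi> v))"
    unfolding V[symmetric] by (simp add: algebra_simps)
  then show ?thesis using E by (simp add: ising_weight_def flip: exp_add)
qed

lemma override_in_configs:
  assumes "\<eta> \<in> configs n" "B \<subseteq> torus_vertices n" "\<And>v. v \<in> B \<Longrightarrow> \<xi> v \<in> {-1, 1}"
  shows "override_on \<eta> \<xi> B \<in> configs n"
  using assms by (auto simp: configs_def PiE_iff override_on_def extensional_def)

text \<open>Overwriting a set of \<open>k\<close> vertices merges at most \<open>2 ^ k\<close> configurations.\<close>

lemma sum_override_le: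
  fixes w :: "(int ^ 'd \<Rightarrow> real) \<Rightarrow> real"
  assumes "B \<subseteq> torus_vertices n" "A \<subseteq> configs n" "A' \<subseteq> configs n"
    and "\<And>\<eta>. \<eta> \<in> A \<Longrightarrow> override_on \<eta> \<xi> B \<in> A'"
    and "\<And>\<eta>. \<eta> \<in> A \<Longrightarrow> w \<eta> \<le> c * w (override_on \<eta> \<xi> B)"
    and "c \<ge> 0" "\<And>\<eta>. w \<eta> \<ge> 0"
  shows "sum w A \<le> 2 ^ card B * c * sum w A'"
proof -
  let ?g = "\<lambda>\<eta>. override_on \<eta> \<xi> B"
  have finA: "finite A" "finite A'" using assms(2,3) finite_subset finite_configs by blast+
  have finB: "finite B" using finite_subset[OF assms(1) finite_torus_vertices] .
  have fib: "card {\<eta> \<in> A. ?g \<eta> = \<zeta>} \<le> 2 ^ card B" for \<zeta>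
  proof -
    \<comment> \<open>Configurations with the same overwritten image agree off \<open>B\<close>, so
      their values on \<open>B\<close> tell them apart.\<close>
    have "inj_on (\<lambda>\<eta>. restrict \<eta> B) {\<eta> \<in> A. ?g \<eta> = \<zeta>}"
    proof (rule inj_onI, rule ext)
      fix \<eta> \<eta>' v
      assume *: "\<eta> \<in> {\<eta> \<in> A. ?g \<eta> = \<zeta>}" "\<eta>' \<in> {\<eta> \<in> A. ?g \<eta> = \<zeta>}" and r: "restrict \<eta> B = restrict \<eta>' B"
      show "\<eta> v = \<eta>' v"
      proof (cases "v \<in> B")
        case True then show ?thesis using fun_cong[OF r, of v] by simp
      next
        case False
        have "?g \<eta> v = ?g \<eta>' v" using * by simp
        then show ?thesis using False by simp
      qed
    qed
    moreover have "(\<lambda>\<eta>. restrict \<eta> B) ` {\<eta> \<in> A. ?g \<eta> = \<zeta>} \<subseteq> B \<rightarrow>\<^sub>E {-1, 1}"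
      using assms(1,2) configs_values by fastforce
    ultimately have "card {\<eta> \<in> A. ?g \<eta> = \<zeta>} \<le> card (B \<rightarrow>\<^sub>E {-1, 1 :: real})"
      using finB by (intro card_inj_on_le[where f = "\<lambda>\<eta>. restrict \<eta> B"]) (auto intro: finite_PiE)
    also have "card (B \<rightarrow>\<^sub>E {-1, 1 :: real}) = card {-1, 1 :: real} ^ card B"
      using finB by (simp add: card_PiE)
    also have "card {-1, 1 :: real} = 2" by simp
    finally show ?thesis .
  qed
  have "sum w A \<le> (\<Sum>\<eta>\<in>A. c * w (?g \<eta>))" using assms(5) by (rule sum_mono)
  \<comment> \<open>The sum is grouped by the overwritten configuration, and each group has at most
    \<open>2 ^ card B\<close> members.\<close>
  also have "\<dots> = (\<Sum>\<zeta>\<in>?g ` A. \<Sum>\<eta> | \<eta> \<in> A \<and> ?g \<eta> = \<zeta>. c * w (?g \<eta>))"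
    by (rule sum.image_gen[OF finA(1)])
  also have "\<dots> = (\<Sum>\<zeta>\<in>?g ` A. real (card {\<eta> \<in> A. ?g \<eta> = \<zeta>}) * (c * w \<zeta>))"
    by (intro sum.cong refl) simp
  also have "\<dots> \<le> (\<Sum>\<zeta>\<in>?g ` A. 2 ^ card B * (c * w \<zeta>))"
  proof (intro sum_mono mult_right_mono)
    fix \<zeta>
    show "real (card {\<eta> \<in> A. ?g \<eta> = \<zeta>}) \<le> 2 ^ card B"
      using of_nat_mono[OF fib[of \<zeta>], where 'a = real] by simp
  qed (use assms in auto)
  also have "\<dots> \<le> (\<Sum>\<zeta>\<in>A'. 2 ^ card B * (c * w \<zeta>))"
    using assms finA by (intro sum_mono2) auto
  finally show ?thesis by (simp add: sum_distrib_left mult.assoc)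
qed

section \<open>Patterns in one ball and in many disjoint balls\<close>

text \<open>By \<open>torus_ball_eq_image\<close> this is the torus ball when \<open>n\<close> is
  admissible and \<open>x\<close> is a vertex; the image form is convenient for counting and
  disjointness.\<close>

definition ball_image :: "ereal \<Rightarrow> real \<Rightarrow> nat \<Rightarrow> nat \<Rightarrow> int ^ 'd \<Rightarrow> (int ^ 'd) set" where
  "ball_image p \<rho> r n x = (\<lambda>z. torus_mod n (x + z)) ` lattice_ball p \<rho> r"

lemma ball_image_subset: "n > 0 \<Longrightarrow> ball_image p \<rho> r n x \<subseteq> torus_vertices n"
  using torus_mod_in_vertices by (auto simp: ball_image_def)

lemma card_ball_image:
  fixes x :: "int ^ 'd"
  assumes "1 \<le> p" "admissible \<rho> r n" "n > 0"
  shows "card (ball_image p \<rho> r n x) = card (lattice_ball p \<rho> r :: (int ^ 'd) set)"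
  unfolding ball_image_def by (intro card_image inj_on_torus_mod_ball assms)

lemma sum_signs:
  assumes "finite S" "\<And>z. z \<in> S \<Longrightarrow> g z = -1 \<or> g z = (1 :: real)"
  shows "sum g S = 2 * real (card {z \<in> S. g z = 1}) - real (card S)"
proof -
  have "sum g S = (\<Sum>z\<in>S. 2 * (if g z = 1 then 1 else 0) - 1)"
    using assms(2) by (intro sum.cong refl) auto
  also have "\<dots> = 2 * (\<Sum>z\<in>S. if g z = 1 then 1 else 0) - real (card S)"
    by (simp add: sum_subtractf flip: sum_distrib_left)
  also have "(\<Sum>z\<in>S. if g z = 1 then 1 else 0) = real (card {z \<in> S. g z = 1})"
    using assms(1) by (simp add: sum.If_cases Int_def)
  finally show ?thesis .
qed

lemma sum_ball_image:
  fixes x :: "int ^ 'd"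
  assumes "1 \<le> p" "admissible \<rho> r n" "n > 0" "\<eta> \<in> configs n" "describes p \<rho> n r \<zeta> x \<eta>"
  shows "(\<Sum>v\<in>ball_image p \<rho> r n x. \<eta> v) = 2 * real (num_plus p \<rho> r \<zeta>) - real (card (lattice_ball p \<rho> r :: (int ^ 'd) set))"
proof -
  have "(\<Sum>v\<in>ball_image p \<rho> r n x. \<eta> v) = (\<Sum>z\<in>lattice_ball p \<rho> r. \<eta> (torus_mod n (x + z)))"
    unfolding ball_image_def using sum.reindex[OF inj_on_torus_mod_ball[OF assms(1-3)]] by simp
  also have "\<dots> = (\<Sum>z\<in>lattice_ball p \<rho> r. \<zeta> z)" using assms(5) by (simp add: describes_def)
  also have "\<dots> = 2 * real (card {z \<in> lattice_ball p \<rho> r. \<zeta> z = 1}) - real (card (lattice_ball p \<rho> r :: (int ^ 'd) set))"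
  proof (intro sum_signs finite_lattice_ball assms(1))
    fix z :: "int ^ 'd" assume "z \<in> lattice_ball p \<rho> r"
    then show "\<zeta> z = -1 \<or> \<zeta> z = 1"
      using assms(5) configs_values[OF assms(4) torus_mod_in_vertices[OF assms(3)], of "x + z"]
      by (simp add: describes_def)
  qed
  finally show ?thesis by (simp add: num_plus_def)
qed

text \<open>The error term of \<open>ising_weight_ratio\<close> for a ball. It does not depend on
  \<open>n\<close>, so it only affects constants. The type argument supplies the dimension.\<close>

definition energy_const :: "'d::finite itself \<Rightarrow> ereal \<Rightarrow> real \<Rightarrow> nat \<Rightarrow> real \<Rightarrow> real" where
  "energy_const _ p \<rho> r b0 =
    2 * b0 * card (lattice_ball p \<rho> r :: (int ^ 'd) set) * card (steps \<rho> :: (int ^ 'd) set)"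

text \<open>Many \<open>+1\<close>'s in a ball are unlikely: erase them all.\<close>

lemma weight_many_plus_le:
  fixes x :: "int ^ 'd"
  assumes "1 \<le> p" "admissible \<rho> r n" "x \<in> torus_vertices n" "\<alpha> < 0" "\<bar>\<beta>\<bar> \<le> b0"
  shows "sum (ising_weight p \<rho> n \<alpha> \<beta>) {\<eta> \<in> configs n. k \<le> num_plus p \<rho> r (local_view p \<rho> n r x \<eta>)}
    \<le> 2 ^ card (lattice_ball p \<rho> r :: (int ^ 'd) set) * exp (2 * \<alpha> * k + energy_const TYPE('d) p \<rho> r b0)
      * sum (ising_weight p \<rho> n \<alpha> \<beta>) (configs n :: (int ^ 'd \<Rightarrow> real) set)"
proof -
  have n: "n > 0" using assms torus_vertices_pos by blast
  let ?B = "ball_image p \<rho> r n x" and ?w = "ising_weight p \<rho> n \<alpha> \<beta> :: (int ^ 'd \<Rightarrow> real) \<Rightarrow> real"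
  let ?m = "\<lambda>_ :: int ^ 'd. - 1 :: real"
  let ?A = "{\<eta> \<in> configs n. k \<le> num_plus p \<rho> r (local_view p \<rho> n r x \<eta>)}"
  note card = card_ball_image[OF assms(1,2) n, of x]
  have over: "override_on \<eta> ?m ?B \<in> configs n" if "\<eta> \<in> configs n" for \<eta>
    using that ball_image_subset[OF n, of p \<rho> r x] by (intro override_in_configs) auto
  have "sum ?w ?A \<le> 2 ^ card ?B * exp (2 * \<alpha> * k + energy_const TYPE('d) p \<rho> r b0) * sum ?w (configs n)"
  proof (rule sum_override_le[where \<xi> = ?m])
    fix \<eta> assume \<eta>: "\<eta> \<in> ?A"
    let ?\<xi> = "override_on \<eta> ?m ?B"
    show "?\<xi> \<in> configs n" using over \<eta> by auto
    have "describes p \<rho> n r (\<lambda>z. -1) x ?\<xi>" by (simp add: describes_def ball_image_def override_on_def)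
    then have "(\<Sum>v\<in>?B. ?\<xi> v) = - real (card (lattice_ball p \<rho> r :: (int ^ 'd) set))"
      using sum_ball_image[OF assms(1,2) n] over \<eta> by (fastforce simp: num_plus_def)
    moreover have "(\<Sum>v\<in>?B. \<eta> v) = 2 * real (num_plus p \<rho> r (local_view p \<rho> n r x \<eta>)) - real (card (lattice_ball p \<rho> r :: (int ^ 'd) set))"
      using \<eta> by (intro sum_ball_image assms n describes_local_view) auto
    ultimately have "2 * real k \<le> (\<Sum>v\<in>?B. \<eta> v) - (\<Sum>v\<in>?B. ?\<xi> v)" using \<eta> by simp
    \<comment> \<open>Since \<alpha> is negative, erasing at least \<open>k\<close> plus signs gives
      an upper bound on the exponent.\<close>
    then have "\<alpha> * ((\<Sum>v\<in>?B. \<eta> v) - (\<Sum>v\<in>?B. ?\<xi> v)) \<le> \<alpha> * (2 * real k)"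
      using assms(4) by (intro mult_left_mono_neg) auto
    then have le: "\<alpha> * ((\<Sum>v\<in>?B. \<eta> v) - (\<Sum>v\<in>?B. ?\<xi> v)) \<le> 2 * \<alpha> * k" by (simp only: mult.assoc mult.left_commute)
    have "?w \<eta> \<le> exp (\<alpha> * ((\<Sum>v\<in>?B. \<eta> v) - (\<Sum>v\<in>?B. ?\<xi> v)) + 2 * b0 * card ?B * card (steps \<rho> :: (int ^ 'd) set)) * ?w ?\<xi>"
      using \<eta> over by (intro ising_weight_ratio assms ball_image_subset n) auto
    also have "\<dots> \<le> exp (2 * \<alpha> * k + energy_const TYPE('d) p \<rho> r b0) * ?w ?\<xi>"
      using le by (intro mult_right_mono) (auto simp: energy_const_def card less_imp_le[OF ising_weight_pos])
    finally show "?w \<eta> \<le> exp (2 * \<alpha> * k + energy_const TYPE('d) p \<rho> r b0) * ?w ?\<xi>" .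
  qed (use ball_image_subset[OF n, of p \<rho> r x] in \<open>auto intro: less_imp_le[OF ising_weight_pos]\<close>)
  then show ?thesis by (simp add: card)
qed

text \<open>Writing \<open>\<zeta>\<close> into the ball around \<open>x\<close> costs a bounded factor; this replaces independence.\<close>

lemma weight_describes_ge:
  fixes x :: "int ^ 'd"
  assumes "1 \<le> p" "admissible \<rho> r n" "n > 0" "\<alpha> < 0" "\<bar>\<beta>\<bar> \<le> b0"
    and "\<zeta> \<in> local_configs p \<rho> r" "num_plus p \<rho> r \<zeta> \<le> k" "A \<subseteq> configs n"
    and stable: "\<And>\<eta> \<xi>. \<eta> \<in> A \<Longrightarrow> \<xi> \<in> configs n \<Longrightarrow> (\<And>v. v \<notin> ball_image p \<rho> r n x \<Longrightarrow> \<xi> v = \<eta> v) \<Longrightarrow> \<xi> \<in> A"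
  shows "exp (2 * \<alpha> * k - energy_const TYPE('d) p \<rho> r b0) / 2 ^ card (lattice_ball p \<rho> r :: (int ^ 'd) set)
      * sum (ising_weight p \<rho> n \<alpha> \<beta>) A
    \<le> sum (ising_weight p \<rho> n \<alpha> \<beta>) {\<eta> \<in> A. describes p \<rho> n r \<zeta> x \<eta>}"
proof -
  let ?h = "\<lambda>z. torus_mod n (x + z)"
  let ?B = "ball_image p \<rho> r n x" and ?w = "ising_weight p \<rho> n \<alpha> \<beta> :: (int ^ 'd \<Rightarrow> real) \<Rightarrow> real"
  \<comment> \<open>The pattern is carried to the torus ball by inverting the injective
    projection.\<close>
  let ?m = "\<lambda>v. \<zeta> (the_inv_into (lattice_ball p \<rho> r) ?h v)"
  let ?A = "{\<eta> \<in> A. describes p \<rho> n r \<zeta> x \<eta>}" and ?C = "energy_const TYPE('d) p \<rho> r b0"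
  let ?M = "card (lattice_ball p \<rho> r :: (int ^ 'd) set)"
  note card = card_ball_image[OF assms(1-3), of x]
  have inv: "?m (?h z) = \<zeta> z" if "z \<in> lattice_ball p \<rho> r" for z
    using the_inv_into_f_f[OF inj_on_torus_mod_ball[OF assms(1-3), of x] that] by simp
  have m: "?m v \<in> {-1, 1}" if "v \<in> ?B" for v
    using that inv assms(6) by (auto simp: ball_image_def local_configs_def PiE_iff)
  have over: "override_on \<eta> ?m ?B \<in> configs n" if "\<eta> \<in> configs n" for \<eta>
    using that ball_image_subset[OF assms(3), of p \<rho> r x] m by (intro override_in_configs) auto
  have "sum ?w A \<le> 2 ^ card ?B * exp (- 2 * \<alpha> * k + ?C) * sum ?w ?A"
  proof (rule sum_override_le[where \<xi> = ?m])
    fix \<eta> assume \<eta>: "\<eta> \<in> A"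
    let ?\<xi> = "override_on \<eta> ?m ?B"
    have \<eta>c: "\<eta> \<in> configs n" using \<eta> assms(8) by blast
    have desc: "describes p \<rho> n r \<zeta> x ?\<xi>" using inv by (simp add: describes_def ball_image_def override_on_def)
    then show "?\<xi> \<in> ?A" using stable[OF \<eta> over[OF \<eta>c]] by auto
    have "(\<Sum>v\<in>?B. ?\<xi> v) = 2 * real (num_plus p \<rho> r \<zeta>) - real ?M"
      by (rule sum_ball_image[OF assms(1-3) over[OF \<eta>c] desc])
    moreover have "(\<Sum>v\<in>?B. \<eta> v) = 2 * real (num_plus p \<rho> r (local_view p \<rho> n r x \<eta>)) - real ?M"
      using \<eta>c by (intro sum_ball_image assms describes_local_view) auto
    \<comment> \<open>In the worst case the old ball has no plus sign and the new one has
      \<open>k\<close>.\<close>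
    ultimately have "- (2 * real k) \<le> (\<Sum>v\<in>?B. \<eta> v) - (\<Sum>v\<in>?B. ?\<xi> v)" using assms(7) by simp
    then have "\<alpha> * ((\<Sum>v\<in>?B. \<eta> v) - (\<Sum>v\<in>?B. ?\<xi> v)) \<le> \<alpha> * (- (2 * real k))"
      using assms(4) by (intro mult_left_mono_neg) auto
    then have le: "\<alpha> * ((\<Sum>v\<in>?B. \<eta> v) - (\<Sum>v\<in>?B. ?\<xi> v)) \<le> - 2 * \<alpha> * k" by (simp only: algebra_simps)
    have "?w \<eta> \<le> exp (\<alpha> * ((\<Sum>v\<in>?B. \<eta> v) - (\<Sum>v\<in>?B. ?\<xi> v)) + 2 * b0 * card ?B * card (steps \<rho> :: (int ^ 'd) set)) * ?w ?\<xi>"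
      using \<eta>c over by (intro ising_weight_ratio assms ball_image_subset) auto
    also have "\<dots> \<le> exp (- 2 * \<alpha> * k + ?C) * ?w ?\<xi>"
      using le by (intro mult_right_mono) (auto simp: energy_const_def card less_imp_le[OF ising_weight_pos])
    finally show "?w \<eta> \<le> exp (- 2 * \<alpha> * k + ?C) * ?w ?\<xi>" .
  qed (use assms(8) ball_image_subset[OF assms(3), of p \<rho> r x] in \<open>auto intro: less_imp_le[OF ising_weight_pos]\<close>)
  \<comment> \<open>Dividing by the positive constant turns the upper bound on \<open>A\<close> into
    the desired lower bound.\<close>
  then have "exp (2 * \<alpha> * k - ?C) / 2 ^ ?M * sum ?w A
      \<le> exp (2 * \<alpha> * k - ?C) / 2 ^ ?M * (2 ^ ?M * exp (- 2 * \<alpha> * k + ?C) * sum ?w ?A)"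
    unfolding card by (intro mult_left_mono) auto
  also have "\<dots> = exp (2 * \<alpha> * k - ?C) * exp (- 2 * \<alpha> * k + ?C) * sum ?w ?A" by simp
  also have "\<dots> = sum ?w ?A" by (simp flip: exp_add)
  finally show ?thesis .
qed

text \<open>A chain rule over the centres: given that the pattern is missed at all earlier centres,
  it is missed at the next one with conditional probability at most 1 - \<delta>, which is at most
  exp(-\<delta>).\<close>

lemma weight_no_describes_le:
  fixes P :: "(int ^ 'd) set" and \<delta> :: real
  assumes "1 \<le> p" "admissible \<rho> r n" "n > 0" "\<alpha> < 0" "\<bar>\<beta>\<bar> \<le> b0"
    and "\<zeta> \<in> local_configs p \<rho> r" "num_plus p \<rho> r \<zeta> \<le> k"
    and "finite P" "disjoint_family_on (ball_image p \<rho> r n) P"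
  defines "\<delta> \<equiv> exp (2 * \<alpha> * k - energy_const TYPE('d) p \<rho> r b0) / 2 ^ card (lattice_ball p \<rho> r :: (int ^ 'd) set)"
  shows "sum (ising_weight p \<rho> n \<alpha> \<beta>) {\<eta> \<in> configs n. \<forall>x\<in>P. \<not> describes p \<rho> n r \<zeta> x \<eta>}
    \<le> exp (- \<delta> * card P) * sum (ising_weight p \<rho> n \<alpha> \<beta>) (configs n :: (int ^ 'd \<Rightarrow> real) set)"
  using assms(8,9)
proof (induction P)
  case empty
  then show ?case by simp
next
  case (insert x P)
  let ?w = "ising_weight p \<rho> n \<alpha> \<beta> :: (int ^ 'd \<Rightarrow> real) \<Rightarrow> real"
  let ?A = "{\<eta> \<in> configs n. \<forall>x\<in>P. \<not> describes p \<rho> n r \<zeta> x \<eta>}"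
  let ?D = "{\<eta> \<in> ?A. describes p \<rho> n r \<zeta> x \<eta>}"
  have dis: "disjoint_family_on (ball_image p \<rho> r n) P" "\<And>y. y \<in> P \<Longrightarrow> ball_image p \<rho> r n y \<inter> ball_image p \<rho> r n x = {}"
    using insert by (auto simp: disjoint_family_on_def)
  \<comment> \<open>The balls are disjoint, so a change inside the new ball cannot affect the event
    at the earlier centres.\<close>
  have "\<xi> \<in> ?A" if "\<eta> \<in> ?A" "\<xi> \<in> configs n" and eq: "\<And>v. v \<notin> ball_image p \<rho> r n x \<Longrightarrow> \<xi> v = \<eta> v" for \<eta> \<xi>
  proof -
    have "describes p \<rho> n r \<zeta> y \<xi> \<longleftrightarrow> describes p \<rho> n r \<zeta> y \<eta>" if "y \<in> P" for y
      using dis(2)[OF that] eq unfolding describes_def ball_image_def by (metis (no_types, lifting) disjoint_iff imageI)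
    then show ?thesis using that by blast
  qed
  then have D: "\<delta> * sum ?w ?A \<le> sum ?w ?D"
    unfolding \<delta>_def by (intro weight_describes_ge assms) auto
  have "{\<eta> \<in> configs n. \<forall>x\<in>insert x P. \<not> describes p \<rho> n r \<zeta> x \<eta>} = ?A - ?D" by auto
  then have "sum ?w {\<eta> \<in> configs n. \<forall>x\<in>insert x P. \<not> describes p \<rho> n r \<zeta> x \<eta>} = sum ?w ?A - sum ?w ?D"
    by (simp only:) (intro sum_diff, auto)
  also have "\<dots> \<le> (1 - \<delta>) * sum ?w ?A" using D by (simp add: algebra_simps)
  also have "\<dots> \<le> exp (- \<delta>) * sum ?w ?A"
    using exp_ge_add_one_self[of "- \<delta>"]
    by (intro mult_right_mono sum_nonneg) (auto simp: less_imp_le[OF ising_weight_pos])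
  also have "\<dots> \<le> exp (- \<delta>) * (exp (- \<delta> * card P) * sum ?w (configs n))"
    using insert.IH[OF dis(1)] by (intro mult_left_mono) auto
  also have "\<dots> = exp (- \<delta> * card (insert x P)) * sum ?w (configs n)"
  proof -
    have "- \<delta> + - \<delta> * card P = - \<delta> * card (insert x P)" using insert.hyps by (simp add: algebra_simps)
    then show ?thesis by (metis exp_add mult.assoc)
  qed
  finally show ?case .
qed

section \<open>Separated positions and limits\<close>

text \<open>For two vertices, some coordinate is at distance at least \<open>s\<close> both ways
  around the circle, expressed without reduction modulo \<open>n\<close>.\<close>

definition separated :: "nat \<Rightarrow> nat \<Rightarrow> int ^ 'd \<Rightarrow> int ^ 'd \<Rightarrow> bool" where
  "separated s n x y \<longleftrightarrow> (\<exists>j. int s \<le> \<bar>x $ j - y $ j\<bar> \<and> \<bar>x $ j - y $ j\<bar> \<le> int n - int s)"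

text \<open>A path of length at most 2r lifts to a displacement below \<open>s\<close> in every
  coordinate. The upper bound \<open>n - s\<close> excludes a wrap-around, and the lower bound then
  gives the contradiction.\<close>

lemma separated_graph_dist:
  assumes "1 \<le> p" "2 * real r * max \<rho> 0 < real s" "x \<in> torus_vertices n" "separated s n x y"
  shows "graph_dist (torus_adj p \<rho> n) x y > enat (2 * r)"
proof (rule ccontr)
  assume "\<not> graph_dist (torus_adj p \<rho> n) x y > enat (2 * r)"
  then obtain k where k: "k \<le> 2 * r" "(torus_adj p \<rho> n ^^ k) x y"
    by (metis graph_dist_le_iff not_less)
  then obtain w where w: "(lattice_adj p \<rho> ^^ k) 0 w" "y = torus_mod n (x + w)"
    using torus_path_lift[OF k(2) assms(3)] by blast
  obtain j where j: "int s \<le> \<bar>x $ j - y $ j\<bar>" "\<bar>x $ j - y $ j\<bar> \<le> int n - int s"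
    using assms(4) by (auto simp: separated_def)
  have "\<bar>real_of_int (w $ j)\<bar> \<le> real k * max \<rho> 0" using lattice_path_bound[OF assms(1) w(1), of j] by simp
  also have "\<dots> \<le> real (2 * r) * max \<rho> 0" using k(1) by (intro mult_right_mono) auto
  also have "\<dots> < real s" using assms(2) by simp
  finally have ws: "\<bar>w $ j\<bar> < int s" by linarith
  have "y $ j mod int n = (x $ j + w $ j) mod int n" using w(2) by (simp add: torus_mod_def)
  moreover have "\<bar>y $ j - (x $ j + w $ j)\<bar> < int n" using ws j by linarith
  ultimately have "y $ j = x $ j + w $ j" by (rule int_mod_eq_imp_eq)
  then show False using ws j by linarith
qed

lemma separated_ball_disjoint:
  assumes "1 \<le> p" "2 * real r * max \<rho> 0 < real s" "separated s n x y"
  shows "ball_image p \<rho> r n x \<inter> ball_image p \<rho> r n y = {}"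
proof (rule ccontr)
  assume "\<not> ?thesis"
  then obtain z z' where z: "z \<in> lattice_ball p \<rho> r" "z' \<in> lattice_ball p \<rho> r"
    and eq: "torus_mod n (x + z) = torus_mod n (y + z')" by (auto simp: ball_image_def)
  obtain j where j: "int s \<le> \<bar>x $ j - y $ j\<bar>" "\<bar>x $ j - y $ j\<bar> \<le> int n - int s"
    using assms(3) by (auto simp: separated_def)
  have zs: "\<bar>z' $ j - z $ j\<bar> < int s" using lattice_ball_diff_bound[OF assms(1) z, of j] assms(2) by linarith
  have "(x $ j + z $ j) mod int n = (y $ j + z' $ j) mod int n" using eq by (simp add: torus_mod_eq_iff)
  moreover have "\<bar>(x $ j + z $ j) - (y $ j + z' $ j)\<bar> < int n" using zs j by linarith
  ultimately have "x $ j + z $ j = y $ j + z' $ j" by (rule int_mod_eq_imp_eq)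
  then show False using zs j by linarith
qed

text \<open>For \<open>i < m\<close> these are \<open>m\<close> disjoint families of mutually distant vertices, one for each part of a
  basic local sentence.\<close>

definition grid_point :: "nat \<Rightarrow> nat \<Rightarrow> nat \<Rightarrow> int ^ 'd \<Rightarrow> int ^ 'd" where
  "grid_point s m i t = (\<chi> j. int s * (int m * t $ j + int i))"

text \<open>With q = n div (s m), the largest index m t + i is at most m q - 1, and s m q is at most
  n. So a gap \<open>s\<close> remains before the wrap-around.\<close>

lemma grid_coordinate_bounds:
  assumes "0 \<le> t" "t < int (n div (s * m))" "i < m"
  shows "0 \<le> int s * (int m * t + int i)" "int s * (int m * t + int i) \<le> int n - int s"
proof -
  show "0 \<le> int s * (int m * t + int i)" using assms by simp
  have "int m * t + int i + 1 \<le> int m * (t + 1)" using assms by (simp add: algebra_simps)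
  also have "\<dots> \<le> int m * int (n div (s * m))" using assms by (intro mult_left_mono) auto
  finally have "int s * (int m * t + int i + 1) \<le> int s * (int m * int (n div (s * m)))" by (intro mult_left_mono) auto
  also have "\<dots> = int (s * m * (n div (s * m)))" by simp
  also have "\<dots> \<le> int n" by (simp only: of_nat_le_iff times_div_less_eq_dividend)
  finally show "int s * (int m * t + int i) \<le> int n - int s" by (simp add: algebra_simps)
qed

lemma grid_point_in_vertices:
  assumes "s > 0" "i < m" "t \<in> torus_vertices (n div (s * m))"
  shows "grid_point s m i t \<in> torus_vertices n"
  unfolding torus_vertices_def
proof (intro CollectI allI)
  fix j
  show "0 \<le> grid_point s m i t $ j \<and> grid_point s m i t $ j < int n"
    using grid_coordinate_bounds[of "t $ j" n s m i] assms by (auto simp: torus_vertices_def grid_point_def)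
qed

text \<open>Quotient and remainder by \<open>m\<close> recover t and i from m t + i, so distinct
  points have distinct indices in some coordinate, and the factor \<open>s\<close> spreads these
  apart.\<close>

lemma grid_point_separated:
  assumes "s > 0" "i < m" "i' < m" "t \<in> torus_vertices (n div (s * m))" "t' \<in> torus_vertices (n div (s * m))"
    and "i \<noteq> i' \<or> t \<noteq> t'"
  shows "separated s n (grid_point s m i t) (grid_point s m i' t')"
proof -
  let ?c = "\<lambda>i t. int s * (int m * t + int i)"
  have digit: "(int m * a + int l) div int m = a" "(int m * a + int l) mod int m = int l" if "l < m" for a l
    using that by auto
  have "\<exists>j. int m * t $ j + int i \<noteq> int m * t' $ j + int i'"
  proof (rule ccontr)
    assume "\<not> ?thesis"
    then have eq: "int m * t $ j + int i = int m * t' $ j + int i'" for j by blast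
    then have "t $ j = t' $ j" for j by (metis digit(1) assms(2,3))
    moreover have "i = i'" using eq by (metis digit(2) assms(2,3) of_nat_eq_iff)
    ultimately show False using assms(6) by (simp add: vec_eq_iff)
  qed
  then obtain j where j: "int m * t $ j + int i \<noteq> int m * t' $ j + int i'" by blast
  have "int s * 1 \<le> int s * \<bar>(int m * t $ j + int i) - (int m * t' $ j + int i')\<bar>"
    using j by (intro mult_left_mono) auto
  also have "\<dots> = \<bar>?c i (t $ j) - ?c i' (t' $ j)\<bar>" by (simp add: abs_mult flip: right_diff_distrib)
  finally have "int s \<le> \<bar>?c i (t $ j) - ?c i' (t' $ j)\<bar>" by simp
  moreover have "0 \<le> ?c i (t $ j)" "?c i (t $ j) \<le> int n - int s"
      "0 \<le> ?c i' (t' $ j)" "?c i' (t' $ j) \<le> int n - int s"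
    using assms by (auto intro!: grid_coordinate_bounds simp: torus_vertices_def simp del: of_nat_mult)
  then have "\<bar>?c i (t $ j) - ?c i' (t' $ j)\<bar> \<le> int n - int s" by linarith
  ultimately show ?thesis by (auto simp: separated_def grid_point_def)
qed

section \<open>Bounds on the probability of the sentence\<close>

lemma sum_UN_le_sum:
  fixes w :: "'a \<Rightarrow> real"
  assumes "finite J" "\<And>i. i \<in> J \<Longrightarrow> finite (F i)" "\<And>x. w x \<ge> 0" "A \<subseteq> (\<Union>i\<in>J. F i)"
  shows "sum w A \<le> (\<Sum>i\<in>J. sum w (F i))"
proof -
  have "sum w A \<le> sum w (\<Union>i\<in>J. F i)" using assms by (intro sum_mono2) auto
  also have "\<dots> \<le> (\<Sum>i\<in>J. sum w (F i))"
    using assms(1,2)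
  proof (induction J)
    case (insert i J)
    have "sum w (F i \<union> (\<Union>i\<in>J. F i)) + sum w (F i \<inter> (\<Union>i\<in>J. F i)) = sum w (F i) + sum w (\<Union>i\<in>J. F i)"
      using insert by (intro sum.union_inter) auto
    moreover have "sum w (F i \<inter> (\<Union>i\<in>J. F i)) \<ge> 0" using assms(3) by (intro sum_nonneg) auto
    moreover have "sum w (\<Union>i\<in>J. F i) \<le> (\<Sum>i\<in>J. sum w (F i))" using insert by auto
    ultimately show ?case using insert.hyps by simp
  qed simp
  finally show ?thesis .
qed

lemma ising_prob_le_one: "ising_prob p \<rho> I a b L n \<le> 1"
  unfolding ising_prob_eq
  by (subst divide_le_eq_1) (auto simp: partition_pos less_imp_le[OF ising_weight_pos] intro!: sum_mono2)

lemma ising_prob_nonneg: "0 \<le> ising_prob p \<rho> I a b L n"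
  by (simp add: ising_prob_def)

text \<open>In any model of \<open>L\<close>, the centre chosen for part \<open>i\<close> sees at
  least \<open>k\<close> plus signs. A union bound over all centres for this single part suffices;
  it is later applied to a part attaining the index.\<close>

lemma ising_prob_le:
  fixes I :: "nat \<Rightarrow> 'r \<Rightarrow> int ^ 'd \<Rightarrow> int ^ 'd \<Rightarrow> bool"
  assumes "1 \<le> p" "torus_interpretation p \<rho> I" "admissible \<rho> (radius L) n" "a n < 0" "\<bar>b n\<bar> \<le> b0"
    and "i < length (parts L)"
    and "\<And>\<zeta>. \<zeta> \<in> descriptions_implying p \<rho> I (radius L) (parts L ! i) \<Longrightarrow> k \<le> num_plus p \<rho> (radius L) \<zeta>"
  shows "ising_prob p \<rho> I a b L n \<le>
    2 ^ card (lattice_ball p \<rho> (radius L) :: (int ^ 'd) set) * exp (energy_const TYPE('d) p \<rho> (radius L) b0)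
      * (exp (2 * a n * k) * real n ^ CARD('d))"
proof -
  let ?w = "ising_weight p \<rho> n (a n) (b n) :: (int ^ 'd \<Rightarrow> real) \<Rightarrow> real"
  let ?Z = "sum ?w (configs n)" and ?r = "radius L"
  let ?F = "\<lambda>x. {\<eta> \<in> configs n. k \<le> num_plus p \<rho> ?r (local_view p \<rho> n ?r x \<eta>)}"
  let ?c = "2 ^ card (lattice_ball p \<rho> ?r :: (int ^ 'd) set) * exp (2 * a n * k + energy_const TYPE('d) p \<rho> ?r b0)"
  have "sum ?w {\<eta> \<in> configs n. models p \<rho> I n \<eta> L} \<le> (\<Sum>x\<in>torus_vertices n. sum ?w (?F x))"
  proof (rule sum_UN_le_sum)
    show "{\<eta> \<in> configs n. models p \<rho> I n \<eta> L} \<subseteq> (\<Union>x\<in>torus_vertices n. ?F x)"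
    proof safe
      fix \<eta> assume \<eta>: "\<eta> \<in> configs n" "models p \<rho> I n \<eta> L"
      then obtain x where x: "x i \<in> torus_vertices n" "sat_local p \<rho> I n \<eta> ?r (parts L ! i) (x i)"
        using assms(6) unfolding models_def by blast
      have "local_view p \<rho> n ?r (x i) \<eta> \<in> descriptions_implying p \<rho> I ?r (parts L ! i)"
        by (rule local_view_implying[OF assms(1,2,3) x(1) \<eta>(1) x(2)])
      then show "\<eta> \<in> (\<Union>x\<in>torus_vertices n. ?F x)" using \<eta> x assms(7) by blast
    qed
  qed (auto intro: less_imp_le[OF ising_weight_pos])
  also have "\<dots> \<le> (\<Sum>x\<in>(torus_vertices n :: (int ^ 'd) set). ?c * ?Z)"
    using assms by (intro sum_mono weight_many_plus_le) auto
  also have "\<dots> = real n ^ CARD('d) * ?c * ?Z" by (simp add: card_torus_vertices)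
  finally have "ising_prob p \<rho> I a b L n \<le> real n ^ CARD('d) * ?c"
    unfolding ising_prob_eq by (subst pos_divide_le_eq[OF partition_pos])
  then show ?thesis by (simp add: exp_add mult_ac)
qed

text \<open>If each pattern \<zeta> i occurs at a point of the i-th grid family, these points
  witness \<open>L\<close>, since points of different families are far apart. Failure therefore
  means that some family misses its pattern everywhere.\<close>

lemma ising_prob_ge:
  fixes I :: "nat \<Rightarrow> 'r \<Rightarrow> int ^ 'd \<Rightarrow> int ^ 'd \<Rightarrow> bool"
  assumes "1 \<le> p" "admissible \<rho> (radius L) n" "n > 0" "a n < 0" "\<bar>b n\<bar> \<le> b0"
    and "s > 0" "2 * real (radius L) * max \<rho> 0 < real s" "length (parts L) \<le> m"
    and \<zeta>: "\<And>i. i < length (parts L) \<Longrightarrow> \<zeta> i \<in> descriptions_implying p \<rho> I (radius L) (parts L ! i)"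
      "\<And>i. i < length (parts L) \<Longrightarrow> num_plus p \<rho> (radius L) (\<zeta> i) \<le> k"
  defines "\<delta> \<equiv> exp (2 * a n * k - energy_const TYPE('d) p \<rho> (radius L) b0) / 2 ^ card (lattice_ball p \<rho> (radius L) :: (int ^ 'd) set) :: real"
  shows "ising_prob p \<rho> I a b L n \<ge>
    1 - real (length (parts L)) * exp (- \<delta> * real (n div (s * m)) ^ CARD('d))"
proof -
  let ?w = "ising_weight p \<rho> n (a n) (b n) :: (int ^ 'd \<Rightarrow> real) \<Rightarrow> real"
  let ?C = "configs n :: (int ^ 'd \<Rightarrow> real) set"
  let ?Z = "sum ?w ?C" and ?r = "radius L" and ?l = "length (parts L)" and ?q = "n div (s * m)"
  let ?T = "torus_vertices ?q :: (int ^ 'd) set"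
  let ?P = "\<lambda>i. grid_point s m i ` ?T"
  let ?F = "\<lambda>i. {\<eta> \<in> ?C. \<forall>x\<in>?P i. \<not> describes p \<rho> n ?r (\<zeta> i) x \<eta>}"
  have irrefl: "\<not> separated s n x x" for x :: "int ^ 'd" using assms(6) by (simp add: separated_def)
  have "sum ?w ?C - sum ?w {\<eta> \<in> ?C. models p \<rho> I n \<eta> L} = sum ?w (?C - {\<eta> \<in> ?C. models p \<rho> I n \<eta> L})"
    by (intro sum_diff[symmetric]) auto
  also have "\<dots> \<le> (\<Sum>i<?l. sum ?w (?F i))"
  proof (rule sum_UN_le_sum)
    show "?C - {\<eta> \<in> ?C. models p \<rho> I n \<eta> L} \<subseteq> (\<Union>i\<in>{..<?l}. ?F i)"
    proof (rule subsetI, rule ccontr)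
      fix \<eta> assume \<eta>: "\<eta> \<in> ?C - {\<eta> \<in> ?C. models p \<rho> I n \<eta> L}" and "\<eta> \<notin> (\<Union>i\<in>{..<?l}. ?F i)"
      then have "\<forall>i. \<exists>t. i < ?l \<longrightarrow> t \<in> ?T \<and> describes p \<rho> n ?r (\<zeta> i) (grid_point s m i t) \<eta>" by blast
      then obtain t where t: "\<And>i. i < ?l \<Longrightarrow> t i \<in> ?T"
          "\<And>i. i < ?l \<Longrightarrow> describes p \<rho> n ?r (\<zeta> i) (grid_point s m i (t i)) \<eta>" by metis
      have "models p \<rho> I n \<eta> L"
        unfolding models_def
      proof (intro exI[of _ "\<lambda>i. grid_point s m i (t i)"] conjI allI impI)
        fix i assume i: "i < ?l"
        show V: "grid_point s m i (t i) \<in> torus_vertices n"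
          using grid_point_in_vertices[OF assms(6) _ t(1)[OF i]] i assms(8) by simp
        show "sat_local p \<rho> I n \<eta> ?r (parts L ! i) (grid_point s m i (t i))"
          using \<zeta>(1)[OF i] V t(2)[OF i] \<eta> assms(2) by (auto simp: descriptions_implying_def)
      next
        fix j i assume "j < ?l" "i < j"
        then have ij: "i < ?l" "j < ?l" "i < m" "j < m" "i \<noteq> j" using assms(8) by auto
        have "separated s n (grid_point s m i (t i)) (grid_point s m j (t j))"
          using grid_point_separated[OF assms(6) ij(3,4) t(1)[OF ij(1)] t(1)[OF ij(2)]] ij(5) by blast
        then show "graph_dist (torus_adj p \<rho> n) (grid_point s m i (t i)) (grid_point s m j (t j)) > enat (2 * ?r)"
          by (rule separated_graph_dist[OF assms(1,7) grid_point_in_vertices[OF assms(6) ij(3) t(1)[OF ij(1)]]])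
      qed
      then show False using \<eta> by blast
    qed
  qed (auto intro: less_imp_le[OF ising_weight_pos])
  also have "\<dots> \<le> (\<Sum>i<?l. exp (- \<delta> * real ?q ^ CARD('d)) * ?Z)"
  proof (rule sum_mono)
    fix i assume "i \<in> {..<?l}"
    then have i: "i < ?l" "i < m" using assms(8) by auto
    have sep: "separated s n (grid_point s m i t) (grid_point s m i t')" if "t \<in> ?T" "t' \<in> ?T" "t \<noteq> t'" for t t'
      using grid_point_separated[OF assms(6) i(2) i(2) that(1,2)] that(3) by blast
    have "inj_on (grid_point s m i) ?T" using sep irrefl by (metis inj_onI)
    then have card: "card (?P i) = ?q ^ CARD('d)" by (simp add: card_image card_torus_vertices)
    have "disjoint_family_on (ball_image p \<rho> ?r n) (?P i)"
      unfolding disjoint_family_on_def using sep separated_ball_disjoint[OF assms(1,7)] by fastforce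
    moreover have "\<zeta> i \<in> local_configs p \<rho> ?r" using \<zeta>(1)[OF i(1)] by (simp add: descriptions_implying_def)
    ultimately have "sum ?w (?F i) \<le> exp (- \<delta> * card (?P i)) * ?Z"
      unfolding \<delta>_def using assms(1-5) \<zeta>(2)[OF i(1)] by (intro weight_no_describes_le) auto
    then show "sum ?w (?F i) \<le> exp (- \<delta> * real ?q ^ CARD('d)) * ?Z" by (simp add: card)
  qed
  also have "\<dots> = real ?l * exp (- \<delta> * real ?q ^ CARD('d)) * ?Z" by simp
  finally have "(1 - real ?l * exp (- \<delta> * real ?q ^ CARD('d))) * ?Z \<le> sum ?w {\<eta> \<in> ?C. models p \<rho> I n \<eta> L}"
    by (simp add: algebra_simps)
  then show ?thesis unfolding ising_prob_eq by (simp add: pos_le_divide_eq[OF partition_pos])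
qed

section \<open>Limits\<close>

lemma eventually_admissible: "\<forall>\<^sub>F n in sequentially. admissible \<rho> r n \<and> n > 0"
proof -
  have "\<forall>\<^sub>F n in sequentially. real n > 2 * \<rho> * (real r + 1)"
    using filterlim_real_sequentially by (simp add: filterlim_at_top_dense)
  then show ?thesis using eventually_gt_at_top[of 0] by eventually_elim (simp add: admissible_def)
qed

lemma ising_prob_tendsto_0:
  fixes I :: "nat \<Rightarrow> 'r \<Rightarrow> int ^ 'd \<Rightarrow> int ^ 'd \<Rightarrow> bool"
  assumes "1 \<le> p" "torus_interpretation p \<rho> I" "\<And>n. a n < 0" "\<And>n. \<bar>b n\<bar> \<le> b0"
    and "i < length (parts L)"
    and "\<And>\<zeta>. \<zeta> \<in> descriptions_implying p \<rho> I (radius L) (parts L ! i) \<Longrightarrow> k \<le> num_plus p \<rho> (radius L) \<zeta>"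
    and lim: "(\<lambda>n. exp (2 * a n * k) * real n ^ CARD('d)) \<longlonglongrightarrow> 0"
  shows "ising_prob p \<rho> I a b L \<longlonglongrightarrow> 0"
proof (rule tendsto_sandwich[where f = "\<lambda>_. 0"])
  let ?c = "2 ^ card (lattice_ball p \<rho> (radius L) :: (int ^ 'd) set) * exp (energy_const TYPE('d) p \<rho> (radius L) b0)"
  show "\<forall>\<^sub>F n in sequentially. ising_prob p \<rho> I a b L n \<le> ?c * (exp (2 * a n * k) * real n ^ CARD('d))"
    using eventually_admissible[of \<rho> "radius L"] by eventually_elim (rule ising_prob_le, use assms in auto)
  show "(\<lambda>n. ?c * (exp (2 * a n * k) * real n ^ CARD('d))) \<longlonglongrightarrow> 0"
    using tendsto_mult_left[OF lim, of ?c] by simp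
qed (auto simp: ising_prob_nonneg)

lemma ising_prob_tendsto_1:
  fixes I :: "nat \<Rightarrow> 'r \<Rightarrow> int ^ 'd \<Rightarrow> int ^ 'd \<Rightarrow> bool"
  assumes "1 \<le> p" "\<And>n. a n < 0" "\<And>n. \<bar>b n\<bar> \<le> b0"
    and \<zeta>: "\<And>i. i < length (parts L) \<Longrightarrow> \<zeta> i \<in> descriptions_implying p \<rho> I (radius L) (parts L ! i)"
      "\<And>i. i < length (parts L) \<Longrightarrow> num_plus p \<rho> (radius L) (\<zeta> i) \<le> k"
    and lim: "filterlim (\<lambda>n. exp (2 * a n * k) * real n ^ CARD('d)) at_top sequentially"
  shows "ising_prob p \<rho> I a b L \<longlonglongrightarrow> 1"
proof -
  let ?l = "length (parts L)" and ?r = "radius L"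
  let ?M = "card (lattice_ball p \<rho> ?r :: (int ^ 'd) set)"
  let ?C = "energy_const TYPE('d) p \<rho> ?r b0"
  \<comment> \<open>The spacing exceeds the coordinate diameter of a ball.\<close>
  obtain s :: nat where s0: "2 * real ?r * max \<rho> 0 < real s" using reals_Archimedean2 by blast
  moreover have "0 \<le> 2 * real ?r * max \<rho> 0" by simp
  ultimately have s: "s > 0" by linarith
  \<comment> \<open>The successor keeps \<open>m\<close> positive when the sentence has no
    parts.\<close>
  define m where "m = Suc ?l"
  define h where "h = 2 * real (s * m)"
  have sm: "s * m > 0" using s by (simp add: m_def)
  then have h: "h > 0" unfolding h_def by (simp del: of_nat_mult)
  let ?c = "exp (- ?C) / 2 ^ ?M / h ^ CARD('d)"
  let ?f = "\<lambda>n. ?c * (exp (2 * a n * k) * real n ^ CARD('d))"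
  have c: "?c > 0" using h by (intro divide_pos_pos zero_less_power) auto
  have lower: "\<forall>\<^sub>F n in sequentially. 1 - real ?l * exp (- ?f n) \<le> ising_prob p \<rho> I a b L n"
    using eventually_admissible[of \<rho> ?r] eventually_ge_at_top[of "2 * (s * m)"]
  proof eventually_elim
    case (elim n)
    let ?q = "n div (s * m)" and ?\<delta> = "exp (2 * a n * k - ?C) / 2 ^ ?M"
    \<comment> \<open>Rounding down loses less than s m, which is at most n/2; hence the factor 2 in
      \<open>h\<close>.\<close>
    have "n \<le> 2 * (s * m * ?q)" using dividend_less_times_div[OF sm, of n] elim by linarith
    then have "real n \<le> real (2 * (s * m * ?q))" by (rule of_nat_mono)
    then have "real n / h \<le> real ?q" using h by (simp add: pos_divide_le_eq h_def mult_ac)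
    then have "(real n / h) ^ CARD('d) \<le> real ?q ^ CARD('d)" using h by (intro power_mono) auto
    then have "?\<delta> * (real n / h) ^ CARD('d) \<le> ?\<delta> * real ?q ^ CARD('d)"
      by (intro mult_left_mono) auto
    also have "?\<delta> * (real n / h) ^ CARD('d) = ?f n"
      using h by (simp add: power_divide exp_diff exp_minus field_simps)
    finally have "exp (- ?\<delta> * real ?q ^ CARD('d)) \<le> exp (- ?f n)" by simp
    then have "1 - real ?l * exp (- ?f n) \<le> 1 - real ?l * exp (- ?\<delta> * real ?q ^ CARD('d))"
      by (intro diff_left_mono mult_left_mono) auto
    also have "\<dots> \<le> ising_prob p \<rho> I a b L n"
      using elim assms(1-3) s s0 \<zeta> by (intro ising_prob_ge) (auto simp: m_def)
    finally show ?case .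
  qed
  have "filterlim ?f at_top sequentially"
    using c lim by (intro filterlim_tendsto_pos_mult_at_top[OF tendsto_const]) auto
  then have "(\<lambda>n. exp (- ?f n)) \<longlonglongrightarrow> 0"
    by (intro filterlim_compose[OF exp_at_bot]) (simp add: filterlim_uminus_at_bot)
  from tendsto_diff[OF tendsto_const[of 1] tendsto_mult_left[OF this, of "real ?l"]]
  have "(\<lambda>n. 1 - real ?l * exp (- ?f n)) \<longlonglongrightarrow> 1" by simp
  from tendsto_sandwich[OF lower _ this tendsto_const] show ?thesis by (simp add: ising_prob_le_one)
qed

section \<open>The index and the threshold\<close>

text \<open>The views in one model show that every part has a description, so the minima are
  attained and the index is finite. A part attaining the maximum is claimed only for k > 0, since
  there may be no parts at all.\<close>

lemma index_of_satisfiable: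
  fixes I :: "nat \<Rightarrow> 'r \<Rightarrow> int ^ 'd \<Rightarrow> int ^ 'd \<Rightarrow> bool"
  assumes "1 \<le> p" "torus_interpretation p \<rho> I" "satisfiable p \<rho> I L"
  obtains \<zeta> k where "index_of p \<rho> I L = enat k"
    "\<forall>i<length (parts L). \<zeta> i \<in> descriptions_implying p \<rho> I (radius L) (parts L ! i)
       \<and> num_plus p \<rho> (radius L) (\<zeta> i) \<le> k"
    "k > 0 \<longrightarrow> (\<exists>i<length (parts L). \<forall>\<xi>\<in>descriptions_implying p \<rho> I (radius L) (parts L ! i).
       k \<le> num_plus p \<rho> (radius L) \<xi>)"
proof -
  let ?l = "length (parts L)" and ?D = "\<lambda>i. descriptions_implying p \<rho> I (radius L) (parts L ! i)"
  let ?np = "num_plus p \<rho> (radius L) :: (int ^ 'd \<Rightarrow> real) \<Rightarrow> nat"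
  obtain n \<eta> where n: "admissible \<rho> (radius L) n" and \<eta>: "\<eta> \<in> configs n" "models p \<rho> I n \<eta> L"
    using assms(3) by (auto simp: satisfiable_def)
  have ne: "?D i \<noteq> {}" if "i < ?l" for i
    using \<eta>(2) that local_view_implying[OF assms(1,2) n _ \<eta>(1)] unfolding models_def by blast
  have "\<exists>\<zeta>. i < ?l \<longrightarrow> \<zeta> \<in> ?D i \<and> (\<forall>\<xi>\<in>?D i. ?np \<zeta> \<le> ?np \<xi>)" for i
  proof (cases "i < ?l")
    case True
    then obtain \<zeta> where "\<zeta> \<in> ?D i" using ne by blast
    then show ?thesis
      using ex_has_least_nat[of "\<lambda>\<xi>. \<xi> \<in> ?D i" \<zeta> ?np] by blast
  qed simp
  then obtain \<zeta> where \<zeta>: "\<And>i. i < ?l \<Longrightarrow> \<zeta> i \<in> ?D i"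
      "\<And>i \<xi>. i < ?l \<Longrightarrow> \<xi> \<in> ?D i \<Longrightarrow> ?np (\<zeta> i) \<le> ?np \<xi>" by metis
  have "(INF \<xi>\<in>?D i. enat (?np \<xi>)) = enat (?np (\<zeta> i))" if "i < ?l" for i
    using \<zeta> that by (intro antisym INF_lower INF_greatest) auto
  then have idx: "index_of p \<rho> I L = (SUP i\<in>{..<?l}. enat (?np (\<zeta> i)))"
    using assms(3) by (simp add: index_of_def)
  have "(SUP i\<in>{..<?l}. enat (?np (\<zeta> i))) \<le> enat (\<Sum>i<?l. ?np (\<zeta> i))"
    by (intro SUP_least) (auto intro: member_le_sum)
  then obtain k where k: "index_of p \<rho> I L = enat k" using idx by (metis enat_ile)
  have le: "?np (\<zeta> i) \<le> k" if "i < ?l" for i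
  proof -
    have "enat (?np (\<zeta> i)) \<le> enat k" unfolding k[symmetric] idx using that by (intro SUP_upper) auto
    then show ?thesis by simp
  qed
  have "\<exists>i<?l. \<forall>\<xi>\<in>?D i. k \<le> ?np \<xi>" if "k > 0"
  proof (rule ccontr)
    assume *: "\<not> ?thesis"
    \<comment> \<open>If no part reached \<open>k\<close>, all minima and thus their supremum would
      be at most k - 1.\<close>
    have "?np (\<zeta> i) \<le> k - 1" if "i < ?l" for i using * \<zeta>(2)[OF that] that by fastforce
    then have "enat k \<le> enat (k - 1)" unfolding k[symmetric] idx by (intro SUP_least) auto
    then show False using that by simp
  qed
  then show ?thesis using that[OF k, of \<zeta>] \<zeta>(1) le by blast
qed

text \<open>The 2k-th power turns the threshold quantity into the one that governs both probability
  bounds.\<close>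

lemma threshold_power:
  assumes "k > 0" "n > 0"
  shows "(exp \<alpha> * real n powr (real d / (2 * real k))) ^ (2 * k) = exp (2 * \<alpha> * k) * real n ^ d"
proof -
  have "(real n powr (real d / (2 * real k))) ^ (2 * k) = real n powr (real d / (2 * real k) * real (2 * k))"
    using assms(2) powr_realpow[of "real n powr (real d / (2 * real k))" "2 * k"] by (simp only: powr_powr) simp
  also have "\<dots> = real n ^ d" using assms by (simp add: powr_realpow)
  finally show ?thesis by (simp add: power_mult_distrib mult_ac flip: exp_of_nat_mult)
qed

theorem proposition4p4:
  fixes p :: ereal and \<rho> :: real
    and I :: "nat \<Rightarrow> 'r \<Rightarrow> int ^ 'd \<Rightarrow> int ^ 'd \<Rightarrow> bool"
    and a b :: "nat \<Rightarrow> real" and b0 :: real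
    and L :: "'r local_sentence"
  assumes "1 \<le> p"
    and "torus_interpretation p \<rho> I"
    and "\<And>n. a n < 0"
    and "b0 > 0" and "\<And>n. \<bar>b n\<bar> < b0"
    and "basic_local L"
  shows "(satisfiable p \<rho> I L \<and> index_of p \<rho> I L > 0 \<longrightarrow>
           (((\<lambda>n. exp (a n) * real n powr
                 (real CARD('d) / (2 * real (the_enat (index_of p \<rho> I L))))) \<longlonglongrightarrow> 0)
              \<longrightarrow> ising_prob p \<rho> I a b L \<longlonglongrightarrow> 0) \<and>
           (filterlim (\<lambda>n. exp (a n) * real n powr
                 (real CARD('d) / (2 * real (the_enat (index_of p \<rho> I L))))) at_top sequentially
              \<longrightarrow> ising_prob p \<rho> I a b L \<longlonglongrightarrow> 1)) \<and>
         (index_of p \<rho> I L = 0 \<longrightarrow> ising_prob p \<rho> I a b L \<longlonglongrightarrow> 1)"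
proof (cases "satisfiable p \<rho> I L")
  case False
  \<comment> \<open>The index is \<infinity>, so the premises of both parts fail.\<close>
  then show ?thesis by (simp add: index_of_def)
next
  case True
  have b: "\<bar>b n\<bar> \<le> b0" for n using assms(5)[of n] by simp
  obtain \<zeta> k where k: "index_of p \<rho> I L = enat k"
    and "\<forall>i<length (parts L). \<zeta> i \<in> descriptions_implying p \<rho> I (radius L) (parts L ! i)
       \<and> num_plus p \<rho> (radius L) (\<zeta> i) \<le> k"
    and max: "k > 0 \<longrightarrow> (\<exists>i<length (parts L). \<forall>\<xi>\<in>descriptions_implying p \<rho> I (radius L) (parts L ! i).
       k \<le> num_plus p \<rho> (radius L) \<xi>)"
    by (rule index_of_satisfiable[OF assms(1,2) True])
  then have \<zeta>: "\<And>i. i < length (parts L) \<Longrightarrow> \<zeta> i \<in> descriptions_implying p \<rho> I (radius L) (parts L ! i)"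
      "\<And>i. i < length (parts L) \<Longrightarrow> num_plus p \<rho> (radius L) (\<zeta> i) \<le> k"
    by blast+
  let ?t = "\<lambda>n. exp (a n) * real n powr (real CARD('d) / (2 * real k))"
  let ?u = "\<lambda>n. exp (2 * a n * k) * real n ^ CARD('d)"
  have one: "ising_prob p \<rho> I a b L \<longlonglongrightarrow> 1" if "filterlim ?u at_top sequentially"
    by (rule ising_prob_tendsto_1[where \<zeta> = \<zeta>, OF assms(1,3) b \<zeta> that])
  have power: "\<forall>\<^sub>F n in sequentially. ?t n ^ (2 * k) = ?u n" if "k > 0"
    using eventually_gt_at_top[of 0] by eventually_elim (rule threshold_power[OF that])
  have "ising_prob p \<rho> I a b L \<longlonglongrightarrow> 0" if "k > 0" "?t \<longlonglongrightarrow> 0"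
  proof -
    have "(\<lambda>n. ?t n ^ (2 * k)) \<longlonglongrightarrow> 0"
      using tendsto_power[OF that(2), of "2 * k"] that(1) by (simp only: zero_power)
    then have lim: "?u \<longlonglongrightarrow> 0" using power[OF that(1)] by (rule Lim_transform_eventually)
    have "\<exists>i<length (parts L). \<forall>\<xi>\<in>descriptions_implying p \<rho> I (radius L) (parts L ! i).
        k \<le> num_plus p \<rho> (radius L) \<xi>"
      using max that(1) by simp
    then obtain i where i: "i < length (parts L)"
      and "\<forall>\<xi>\<in>descriptions_implying p \<rho> I (radius L) (parts L ! i). k \<le> num_plus p \<rho> (radius L) \<xi>"
      by blast
    then show ?thesis by (intro ising_prob_tendsto_0[where i = i and k = k, OF assms(1-3) b i _ lim]) blast
  qed
  moreover have "ising_prob p \<rho> I a b L \<longlonglongrightarrow> 1" if "k > 0" "filterlim ?t at_top sequentially"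
  proof (rule one)
    have "filterlim (\<lambda>n. ?t n ^ (2 * k)) at_top sequentially"
      using that by (intro filterlim_pow_at_top) auto
    then show "filterlim ?u at_top sequentially"
      by (rule filterlim_cong[OF refl refl power[OF that(1)], THEN iffD1])
  qed
  moreover have "ising_prob p \<rho> I a b L \<longlonglongrightarrow> 1" if "k = 0"
  proof (rule one)
    have "filterlim (\<lambda>n. real n ^ CARD('d)) at_top sequentially"
      by (intro filterlim_pow_at_top filterlim_real_sequentially) simp
    then show "filterlim ?u at_top sequentially" using that by simp
  qed
  ultimately show ?thesis unfolding k by (simp add: zero_enat_def)
qed

end
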